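(* There exists a non-decreasing function $d:\mathbf{N}^2\to\mathbf{N}$ satisfying $d(\ell,n)=O(\ell\log n)$ and a polynomial-time algorithm that, given an $n$-vertex graph $G$, integers $\ell,m_0\ge 1$, and an assignment $q:V(G)\to\mathbf{Q}_0^+$ of nonnegative rational costs to vertices of $G$, returns either an $m_0$-bounded model of $K_{m_0}$ of depth $d:=d(\ell,n)$ in $G$, or disjoint sets $C,M\subseteq V(G)$ such that (1) $C\cup M$ is a balanced separator in $G$, (2) $q(C)\le q(V(G))/\ell$, and (3) for some $m\le \min(m_0,\omega_d(G))$, $M$ is the support of a $\min(m_0,\omega_d(G))$-bounded model of $K_m$ of depth $d$ in $G$.
   Context: For $X\subseteq V(G)$, $q(X)=\sum_{x\in X}q(x)$. A balanced separator in $G$ is a set $C\subseteq V(G)$ such that each component of $G-C$ has at most $\tfrac{2}{3}|V(G)|$ vertices. A model of $K_m$ in $G$ is a system $\{V_1,\ldots,V_m\}$ of pairwise disjoint subsets of $V(G)$ such that each $G[V_i]$ is connected and for all $1\le i<j\le m$ there is an edge of $G$ with one end in $V_i$ and the other in $V_j$; its support is $V_1\cup\cdots\cup V_m$. The model has depth $d$ if each $G[V_i]$ has radius at most $d$. For $m_0\ge m$, a model of depth $d$ is $m_0$-bounded if $|V_i|\le m_0 d$ for all $i$. $\omega_d(G)$ is the maximum integer $m$ such that $G$ contains a model of $K_m$ of depth $d$. *)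

theory Defs
  imports
    Complex_Main
    "HOL-Library.Landau_Symbols"
    "HOL-Library.Log_Nat"
    "HOL-Computational_Algebra.Polynomial"
begin

section \<open>Graphs, separators and shallow models of complete graphs\<close>

text \<open>A graph is a vertex set together with a set of ordered pairs that contains
  each edge in both orientations.\<close>

definition simple_graph :: "'a set \<Rightarrow> 'a rel \<Rightarrow> bool" where
  "simple_graph V E \<longleftrightarrow> finite V \<and> E \<subseteq> V \<times> V \<and> sym E \<and> irrefl E"

text \<open>\<open>Restr E X\<close> is the edge set of the subgraph induced by \<open>X\<close>.
  A connected graph is nonempty.\<close>

definition induces_connected :: "'a rel \<Rightarrow> 'a set \<Rightarrow> bool" where
  "induces_connected E X \<longleftrightarrow> X \<noteq> {} \<and> (\<forall>x\<in>X. \<forall>y\<in>X. (x, y) \<in> (Restr E X)\<^sup>*)"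

text \<open>Vertex sets of the components of the subgraph induced by \<open>X\<close>.\<close>

definition components :: "'a rel \<Rightarrow> 'a set \<Rightarrow> 'a set set" where
  "components E X = X // (Restr E X)\<^sup>*"

definition balanced_separator :: "'a set \<Rightarrow> 'a rel \<Rightarrow> 'a set \<Rightarrow> bool" where
  "balanced_separator V E C \<longleftrightarrow>
     C \<subseteq> V \<and> (\<forall>K\<in>components E (V - C). real (card K) \<le> 2 / 3 * real (card V))"

text \<open>The distance is meaningful only for vertices joined by a path, and the radius only
  for a finite \<open>X\<close> that induces a connected subgraph; both are used only there.\<close>

definition distance :: "'a rel \<Rightarrow> 'a \<Rightarrow> 'a \<Rightarrow> nat" where
  "distance E x y = (LEAST k. (x, y) \<in> E ^^ k)"

definition radius :: "'a rel \<Rightarrow> 'a set \<Rightarrow> nat" where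
  "radius E X = (MIN x\<in>X. MAX y\<in>X. distance (Restr E X) x y)"

text \<open>The sets of a model are nonempty and pairwise disjoint, hence distinct, so a model of
  the complete graph on \<open>m\<close> vertices is a family of cardinality \<open>m\<close>; its support is the union
  of the family. For \<open>m = 0\<close> it is the empty family.\<close>

definition clique_model :: "'a set \<Rightarrow> 'a rel \<Rightarrow> nat \<Rightarrow> 'a set set \<Rightarrow> bool" where
  "clique_model V E m W \<longleftrightarrow>
     finite W \<and> card W = m \<and> (\<forall>X\<in>W. X \<subseteq> V \<and> induces_connected E X) \<and>
     pairwise disjnt W \<and> pairwise (\<lambda>X Y. \<exists>x\<in>X. \<exists>y\<in>Y. (x, y) \<in> E) W"

definition has_depth :: "'a rel \<Rightarrow> nat \<Rightarrow> 'a set set \<Rightarrow> bool" where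
  "has_depth E d W \<longleftrightarrow> (\<forall>X\<in>W. radius E X \<le> d)"

text \<open>A model of depth \<open>d\<close> is \<open>k\<close>-bounded if its sets have at most \<open>k * d\<close> elements.\<close>

definition is_bounded :: "nat \<Rightarrow> nat \<Rightarrow> 'a set set \<Rightarrow> bool" where
  "is_bounded k d W \<longleftrightarrow> (\<forall>X\<in>W. card X \<le> k * d)"

definition omega :: "'a set \<Rightarrow> 'a rel \<Rightarrow> nat \<Rightarrow> nat" where
  "omega V E d = Max {m. \<exists>W. clique_model V E m W \<and> has_depth E d W}"


section \<open>Polynomial-time algorithms\<close>

text \<open>
  Algorithms are programs of a deterministic while language over binary trees with natural
  numbers at the leaves. A program uses finitely many variables, each holding one tree.
  Time is charged by the logarithmic cost criterion: evaluating an expression costs the sum of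
  the sizes of the values of all its subexpressions, where a number counts with its binary
  length. Hence every step charges for all data it reads and writes, and the time is, up to a
  polynomial, that of a Turing machine.
\<close>

datatype data = Atom nat | Node data data

fun data_size :: "data \<Rightarrow> nat" where
  "data_size (Atom n) = 1 + floorlog 2 n"
| "data_size (Node a b) = 1 + data_size a + data_size b"

datatype exp =
    Var nat
  | Lit nat
  | Mk exp exp
  | Hd exp
  | Tl exp
  | IsNode exp
  | Add exp exp
  | Sub exp exp
  | Mul exp exp

datatype com =
    Skip
  | Assign nat exp
  | Seq com com
  | Cond exp com com
  | While exp com

type_synonym state = "nat \<Rightarrow> data"

text \<open>Operations applied to data of the wrong shape yield a number: the parts of a leaf are
  \<open>0\<close>, and an inner node counts as \<open>0\<close> in arithmetic. Subtraction is truncated.\<close>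

fun num_of :: "data \<Rightarrow> nat" where
  "num_of (Atom n) = n"
| "num_of (Node a b) = 0"

fun hd_of :: "data \<Rightarrow> data" where
  "hd_of (Atom n) = Atom 0"
| "hd_of (Node a b) = a"

fun tl_of :: "data \<Rightarrow> data" where
  "tl_of (Atom n) = Atom 0"
| "tl_of (Node a b) = b"

fun is_node :: "data \<Rightarrow> bool" where
  "is_node (Atom n) = False"
| "is_node (Node a b) = True"

fun eval_exp :: "exp \<Rightarrow> state \<Rightarrow> data" where
  "eval_exp (Var x) s = s x"
| "eval_exp (Lit n) s = Atom n"
| "eval_exp (Mk e f) s = Node (eval_exp e s) (eval_exp f s)"
| "eval_exp (Hd e) s = hd_of (eval_exp e s)"
| "eval_exp (Tl e) s = tl_of (eval_exp e s)"
| "eval_exp (IsNode e) s = Atom (of_bool (is_node (eval_exp e s)))"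
| "eval_exp (Add e f) s = Atom (num_of (eval_exp e s) + num_of (eval_exp f s))"
| "eval_exp (Sub e f) s = Atom (num_of (eval_exp e s) - num_of (eval_exp f s))"
| "eval_exp (Mul e f) s = Atom (num_of (eval_exp e s) * num_of (eval_exp f s))"

fun exp_cost :: "exp \<Rightarrow> state \<Rightarrow> nat" where
  "exp_cost (Var x) s = data_size (eval_exp (Var x) s)"
| "exp_cost (Lit n) s = data_size (eval_exp (Lit n) s)"
| "exp_cost (Mk e f) s = data_size (eval_exp (Mk e f) s) + exp_cost e s + exp_cost f s"
| "exp_cost (Hd e) s = data_size (eval_exp (Hd e) s) + exp_cost e s"
| "exp_cost (Tl e) s = data_size (eval_exp (Tl e) s) + exp_cost e s"
| "exp_cost (IsNode e) s = data_size (eval_exp (IsNode e) s) + exp_cost e s"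
| "exp_cost (Add e f) s = data_size (eval_exp (Add e f) s) + exp_cost e s + exp_cost f s"
| "exp_cost (Sub e f) s = data_size (eval_exp (Sub e f) s) + exp_cost e s + exp_cost f s"
| "exp_cost (Mul e f) s = data_size (eval_exp (Mul e f) s) + exp_cost e s + exp_cost f s"

text \<open>A condition holds if its value is not \<open>Atom 0\<close>.
  \<open>exec c s t s'\<close>: started in \<open>s\<close>, \<open>c\<close> halts in \<open>s'\<close> after time \<open>t\<close>.\<close>

inductive exec :: "com \<Rightarrow> state \<Rightarrow> nat \<Rightarrow> state \<Rightarrow> bool" where
  exec_Skip: "exec Skip s 1 s"
| exec_Assign: "exec (Assign x e) s (1 + exp_cost e s) (s(x := eval_exp e s))"
| exec_Seq: "exec c1 s1 t1 s2 \<Longrightarrow> exec c2 s2 t2 s3 \<Longrightarrow> exec (Seq c1 c2) s1 (t1 + t2) s3"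
| exec_CondTrue: "eval_exp b s \<noteq> Atom 0 \<Longrightarrow> exec c1 s t s' \<Longrightarrow>
    exec (Cond b c1 c2) s (1 + exp_cost b s + t) s'"
| exec_CondFalse: "eval_exp b s = Atom 0 \<Longrightarrow> exec c2 s t s' \<Longrightarrow>
    exec (Cond b c1 c2) s (1 + exp_cost b s + t) s'"
| exec_WhileFalse: "eval_exp b s = Atom 0 \<Longrightarrow> exec (While b c) s (1 + exp_cost b s) s"
| exec_WhileTrue: "eval_exp b s1 \<noteq> Atom 0 \<Longrightarrow> exec c s1 t1 s2 \<Longrightarrow> exec (While b c) s2 t2 s3 \<Longrightarrow>
    exec (While b c) s1 (1 + exp_cost b s1 + t1 + t2) s3"

text \<open>The program reads its input from variable \<open>0\<close> and leaves its output there; all other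
  variables are initially \<open>0\<close>. Programs are deterministic, so the existential quantifier over
  the final state expresses total correctness.\<close>

definition poly_time_algorithm ::
  "com \<Rightarrow> 'i set \<Rightarrow> ('i \<Rightarrow> data) \<Rightarrow> ('i \<Rightarrow> data \<Rightarrow> bool) \<Rightarrow> bool" where
  "poly_time_algorithm c I enc R \<longleftrightarrow>
     (\<exists>p :: nat poly. \<forall>i\<in>I. \<exists>t s. exec c ((\<lambda>_. Atom 0)(0 := enc i)) t s \<and>
        t \<le> poly p (data_size (enc i)) \<and> R i (s 0))"


section \<open>Encoding of inputs and outputs\<close>

definition data_of_list :: "data list \<Rightarrow> data" where
  "data_of_list xs = foldr Node xs (Atom 0)"

text \<open>An instance \<open>(n, E, l, m0, q)\<close> consists of a graph on the vertices \<open>0, \<dots>, n - 1\<close>, the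
  two integers and the costs. The graph is given by its adjacency matrix, numbers are
  written in binary, and costs are reduced fractions.\<close>

type_synonym problem_instance = "nat \<times> nat rel \<times> nat \<times> nat \<times> (nat \<Rightarrow> rat)"

definition data_of_rat :: "rat \<Rightarrow> data" where
  "data_of_rat r = (case quotient_of r of (a, b) \<Rightarrow> Node (Atom (nat a)) (Atom (nat b)))"

definition data_of_instance :: "problem_instance \<Rightarrow> data" where
  "data_of_instance = (\<lambda>(n, E, l, m0, q).
     data_of_list
       [data_of_list (map (\<lambda>u. data_of_list (map (\<lambda>v. Atom (of_bool ((u, v) \<in> E))) [0..<n])) [0..<n]),
        Atom l, Atom m0, data_of_list (map (\<lambda>v. data_of_rat (q v)) [0..<n])])"

definition instances :: "problem_instance set" where
  "instances = {(n, E, l, m0, q).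
     simple_graph {..<n} E \<and> 1 \<le> l \<and> 1 \<le> m0 \<and> (\<forall>v<n. 0 \<le> q v)}"

text \<open>A finite set is output as a list of its elements, in any order and without repetition;
  \<open>r\<close> relates data to the elements they represent.\<close>

definition represents_set :: "(data \<Rightarrow> 'a \<Rightarrow> bool) \<Rightarrow> data \<Rightarrow> 'a set \<Rightarrow> bool" where
  "represents_set r z X \<longleftrightarrow>
     (\<exists>xs zs. distinct xs \<and> set xs = X \<and> list_all2 r zs xs \<and> z = data_of_list zs)"

definition represents_vertices :: "data \<Rightarrow> nat set \<Rightarrow> bool" where
  "represents_vertices = represents_set (\<lambda>z v. z = Atom v)"

text \<open>The tag in the first component tells which kind of result is returned.\<close>

definition returns_model :: "data \<Rightarrow> nat set set \<Rightarrow> bool" where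
  "returns_model z W \<longleftrightarrow> (\<exists>y. z = Node (Atom 0) y \<and> represents_set represents_vertices y W)"

definition returns_sets :: "data \<Rightarrow> nat set \<Rightarrow> nat set \<Rightarrow> bool" where
  "returns_sets z C M \<longleftrightarrow>
     (\<exists>x y. z = Node (Atom 1) (Node x y) \<and> represents_vertices x C \<and> represents_vertices y M)"

end

theory Submission
  imports Defs
begin

text \<open>
  The algorithm maintains a partition of the vertices into \<open>B\<close> (still to be separated), \<open>C\<close>, the
  support \<open>M\<close> of a model \<open>W\<close>, and a rest \<open>R\<close> without edges to \<open>B\<close>, and stops when \<open>B\<close> has at most
  two thirds of the vertices or \<open>W\<close> has \<open>m0\<close> members. Members of \<open>W\<close> without a neighbour in \<open>B\<close>
  are moved to \<open>R\<close>. Otherwise pick in \<open>B\<close> a neighbour of every member (its port) and grow a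
  ball around each port in \<open>B\<close> until the boundary \<open>N\<close> of the ball \<open>S\<close> is light:
  \<open>2 * l * \<mu> N \<le> \<mu> S\<close>. If some \<open>S\<close> has at most half of the vertices of \<open>B\<close>, move \<open>S\<close> to \<open>R\<close> and
  \<open>N\<close> to \<open>C\<close>; the measure of \<open>C\<close> is then paid by that of \<open>R\<close>. Otherwise any two balls meet, so
  the ports are at bounded distance from each other, and the shortest paths from one port to
  all the others form a new member of \<open>W\<close>.

  Ball growing with the costs \<open>q\<close> alone would need a number of steps logarithmic in the ratio of
  the largest and the smallest cost. With the measure \<open>\<mu> v = n * q v + q V\<close> (after scaling \<open>q\<close> to
  integers) every vertex has measure at least \<open>q V\<close> while the total is \<open>2 * n * q V\<close>, so that
  \<open>O(l * log n)\<close> steps suffice, and \<open>2 * l * \<mu> C \<le> \<mu> V\<close> still gives \<open>l * q C \<le> q V\<close>.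

  The running time is polynomial because the functions computable in polynomial time on encodable
  types are closed under composition, conditionals, and folds over lists whose accumulators stay
  polynomially large.
\<close>

section \<open>Polynomial-time functions\<close>

class enc =
  fixes encode :: "'a \<Rightarrow> data"

instantiation data :: enc
begin
definition "encode = (\<lambda>z :: data. z)"
instance ..
end

instantiation nat :: enc
begin
definition "encode = Atom"
instance ..
end

instantiation bool :: enc
begin
definition "encode b = Atom (of_bool b)"
instance ..
end

instantiation prod :: (enc, enc) enc
begin
definition "encode p = Node (encode (fst p)) (encode (snd p))"
instance ..
end

instantiation list :: (enc) enc
begin
primrec encode_list :: "'a list \<Rightarrow> data" where
  "encode_list [] = Atom 0"
| "encode_list (x # xs) = Node (encode x) (encode_list xs)"
instance ..
end

lemmas encode_simps [simp] =
  encode_data_def encode_nat_def encode_bool_def encode_prod_def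

lemma encode_list_eq: "encode xs = data_of_list (map encode xs)"
  by (induction xs) (auto simp: data_of_list_def)

section \<open>Sizes of encoded values\<close>

abbreviation esize :: "'a::enc \<Rightarrow> nat" where
  "esize x \<equiv> data_size (encode x)"

lemma data_size_pos [simp]: "0 < data_size z"
  by (cases z) auto

text \<open>Since \<open>a + b < (a + 1) * (b + 1)\<close>, binary lengths simply add up. Unlike the
  bound by maximum plus one, this has no additive constant, so it iterates well along sums.\<close>

lemma floorlog_add_le: "floorlog 2 (a + b) \<le> floorlog 2 a + floorlog 2 b"
proof -
  have a: "a + 1 \<le> 2 ^ floorlog 2 a" and b: "b + 1 \<le> 2 ^ floorlog 2 b"
    using floorlog_leD[of 2 a, OF order_refl] floorlog_leD[of 2 b, OF order_refl] by auto
  have "a + b < (a + 1) * (b + 1)" by simp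
  also have "\<dots> \<le> 2 ^ (floorlog 2 a + floorlog 2 b)"
    unfolding power_add by (rule mult_mono[OF a b]) auto
  finally show ?thesis by (intro floorlog_leI) auto
qed

lemma floorlog_mult_le: "floorlog 2 (a * b) \<le> floorlog 2 a + floorlog 2 b"
proof -
  have a: "a + 1 \<le> 2 ^ floorlog 2 a" and b: "b + 1 \<le> 2 ^ floorlog 2 b"
    using floorlog_leD[of 2 a, OF order_refl] floorlog_leD[of 2 b, OF order_refl] by auto
  have "a * b < (a + 1) * (b + 1)" by simp
  also have "\<dots> \<le> 2 ^ (floorlog 2 a + floorlog 2 b)"
    unfolding power_add by (rule mult_mono[OF a b]) auto
  finally show ?thesis by (intro floorlog_leI) auto
qed

lemma floorlog_2_simps [simp]: "floorlog 2 0 = 0" "floorlog 2 (Suc 0) = 1"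
  by (simp_all add: compute_floorlog)

lemma data_size_bool [simp]: "data_size (Atom (of_bool P)) \<le> 2"
  by auto

lemma esize_member: "x \<in> set xs \<Longrightarrow> esize x < esize xs"
  by (induction xs) auto

lemma length_le_esize: "length xs < esize xs"
  by (induction xs) auto

lemma esize_append: "esize (xs @ ys) \<le> esize xs + esize ys"
  by (induction xs) auto

lemma esize_filter: "esize (filter P xs) \<le> esize xs"
  by (induction xs) auto

section \<open>Polynomial bounds in the size of the argument\<close>

definition poly_bounded :: "('a::enc \<Rightarrow> nat) \<Rightarrow> bool" where
  "poly_bounded T \<longleftrightarrow> (\<exists>p :: nat poly. \<forall>x. T x \<le> poly p (esize x))"

text \<open>Coefficients are natural numbers, so every polynomial is monotone; this lets size bounds
  be inserted into time bounds.\<close>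

lemma poly_nat_mono: "m \<le> n \<Longrightarrow> poly p m \<le> poly p (n :: nat)"
  by (induction p) (auto intro!: add_mono mult_mono)

lemma poly_bounded_mono: "poly_bounded T \<Longrightarrow> (\<And>x. S x \<le> T x) \<Longrightarrow> poly_bounded S"
  unfolding poly_bounded_def by (blast intro: order_trans)

lemma poly_bounded_const: "poly_bounded (\<lambda>_. k)"
  unfolding poly_bounded_def by (rule exI[of _ "[:k:]"]) simp

lemma poly_bounded_esize: "poly_bounded (\<lambda>x. esize x)"
  unfolding poly_bounded_def by (rule exI[of _ "[:0, 1:]"]) simp

lemma poly_bounded_add: "poly_bounded S \<Longrightarrow> poly_bounded T \<Longrightarrow> poly_bounded (\<lambda>x. S x + T x)"
proof -
  assume "poly_bounded S" "poly_bounded T"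
  then obtain p r where "\<And>x. S x \<le> poly p (esize x)" "\<And>x. T x \<le> poly r (esize x)"
    unfolding poly_bounded_def by blast
  then show ?thesis
    unfolding poly_bounded_def by (intro exI[of _ "p + r"]) (auto intro: add_mono)
qed

lemma poly_bounded_mult: "poly_bounded S \<Longrightarrow> poly_bounded T \<Longrightarrow> poly_bounded (\<lambda>x. S x * T x)"
proof -
  assume "poly_bounded S" "poly_bounded T"
  then obtain p r where "\<And>x. S x \<le> poly p (esize x)" "\<And>x. T x \<le> poly r (esize x)"
    unfolding poly_bounded_def by blast
  then show ?thesis
    unfolding poly_bounded_def by (intro exI[of _ "p * r"]) (auto intro: mult_mono)
qed

lemma poly_bounded_poly:
  assumes "poly_bounded T"
  shows "poly_bounded (\<lambda>x. poly p (T x))"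
proof -
  obtain r where r: "\<And>x. T x \<le> poly r (esize x)"
    using assms unfolding poly_bounded_def by blast
  show ?thesis unfolding poly_bounded_def
    by (rule exI[of _ "pcompose p r"]) (auto simp: poly_pcompose intro!: poly_nat_mono r)
qed


section \<open>Total correctness of programs with an upper bound on the time\<close>

definition runs :: "com \<Rightarrow> state \<Rightarrow> nat \<Rightarrow> (state \<Rightarrow> bool) \<Rightarrow> bool" where
  "runs c s T Q \<longleftrightarrow> (\<exists>t s'. exec c s t s' \<and> t \<le> T \<and> Q s')"

lemma runs_mono: "runs c s T Q \<Longrightarrow> T \<le> T' \<Longrightarrow> (\<And>s'. Q s' \<Longrightarrow> Q' s') \<Longrightarrow> runs c s T' Q'"
  unfolding runs_def by (blast intro: order_trans)

lemma runs_Assign: "Q (s(x := eval_exp e s)) \<Longrightarrow> 1 + exp_cost e s \<le> T \<Longrightarrow> runs (Assign x e) s T Q"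
  unfolding runs_def using exec_Assign by blast

text \<open>The postcondition of the first command is again a \<open>runs\<close> statement, so the
  rule can be applied along a chain of commands without naming intermediate states.\<close>

lemma runs_Seq: "runs c1 s T1 (\<lambda>s'. runs c2 s' T2 Q) \<Longrightarrow> T1 + T2 \<le> T \<Longrightarrow> runs (Seq c1 c2) s T Q"
  unfolding runs_def by (fastforce intro: exec_Seq)

lemma runs_Cond:
  assumes "eval_exp b s \<noteq> Atom 0 \<Longrightarrow> runs c1 s T Q"
    and "eval_exp b s = Atom 0 \<Longrightarrow> runs c2 s T Q"
    and "1 + exp_cost b s + T \<le> T'"
  shows "runs (Cond b c1 c2) s T' Q"
proof (cases "eval_exp b s = Atom 0")
  case True
  with assms(2) obtain t s' where "exec c2 s t s'" "t \<le> T" "Q s'" unfolding runs_def by blast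
  with exec_CondFalse[OF True this(1), of c1] assms(3) show ?thesis unfolding runs_def
    by (intro exI[of _ "1 + exp_cost b s + t"] exI[of _ s']) auto
next
  case False
  with assms(1) obtain t s' where "exec c1 s t s'" "t \<le> T" "Q s'" unfolding runs_def by blast
  with exec_CondTrue[OF False this(1), of c2] assms(3) show ?thesis unfolding runs_def
    by (intro exI[of _ "1 + exp_cost b s + t"] exI[of _ s']) auto
qed

lemma runs_While_False:
  "eval_exp b s = Atom 0 \<Longrightarrow> Q s \<Longrightarrow> 1 + exp_cost b s \<le> T \<Longrightarrow> runs (While b c) s T Q"
  unfolding runs_def using exec_WhileFalse by blast

lemma runs_While_True:
  assumes "eval_exp b s \<noteq> Atom 0" and "runs c s T1 (\<lambda>s'. runs (While b c) s' T2 Q)"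
    and "1 + exp_cost b s + T1 + T2 \<le> T"
  shows "runs (While b c) s T Q"
proof -
  obtain t1 s1 t2 s2 where "exec c s t1 s1" "t1 \<le> T1" "exec (While b c) s1 t2 s2" "t2 \<le> T2" "Q s2"
    using assms(2) unfolding runs_def by blast
  then show ?thesis
    using exec_WhileTrue[OF assms(1), of c t1 s1 t2 s2] assms(3) unfolding runs_def
    by (intro exI[of _ "1 + exp_cost b s + t1 + t2"] exI[of _ s2]) auto
qed

lemma eval_exp_size_le: "data_size (eval_exp e s) \<le> exp_cost e s"
  by (cases e) auto

text \<open>An assignment is charged at least the size of the value it stores, so no variable can
  grow by more than the elapsed time.\<close>

lemma exec_size: "exec c s t s' \<Longrightarrow> data_size (s' v) \<le> data_size (s v) + t"
proof (induction rule: exec.induct)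
  case (exec_Assign x e s)
  then show ?case using eval_exp_size_le[of e s] by auto
qed auto


text \<open>The variable \<open>b\<close> holds both the argument and the result. The program may use only
  variables from \<open>b\<close> on, so that programs for different \<open>b\<close> can be nested.\<close>

definition ptime :: "('a::enc \<Rightarrow> 'b::enc) \<Rightarrow> bool" where
  "ptime f \<longleftrightarrow> (\<forall>b. \<exists>c T. poly_bounded T \<and> (\<forall>s x. s b = encode x \<longrightarrow>
     runs c s (T x) (\<lambda>s'. s' b = encode (f x) \<and> (\<forall>v<b. s' v = s v))))"

lemma ptimeE:
  assumes "ptime f"
  obtains c T where "poly_bounded T"
    "\<And>s x. s b = encode x \<Longrightarrow> runs c s (T x) (\<lambda>s'. s' b = encode (f x) \<and> (\<forall>v<b. s' v = s v))"
proof -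
  from assms obtain c T where c: "poly_bounded T \<and> (\<forall>s x. s b = encode x \<longrightarrow>
     runs c s (T x) (\<lambda>s'. s' b = encode (f x) \<and> (\<forall>v<b. s' v = s v)))"
    unfolding ptime_def by (elim allE[of _ b] exE)
  show ?thesis by (rule that[of T c]) (use c in auto)
qed

text \<open>A result cannot be larger than the argument plus the running time. Composition rests on
  this: the time of the outer function is measured in the size of the intermediate value.\<close>

lemma ptime_poly_bounded:
  assumes "ptime f"
  shows "poly_bounded (\<lambda>x. esize (f x))"
proof -
  obtain c T where T: "poly_bounded T"
    "\<And>s x. s (0::nat) = encode x \<Longrightarrow> runs c s (T x) (\<lambda>s'. s' 0 = encode (f x) \<and> (\<forall>v<0. s' v = s v))"
    by (rule ptimeE[OF assms, of "0"]) (rule that)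
  show ?thesis
  proof (rule poly_bounded_mono[OF poly_bounded_add[OF poly_bounded_esize T(1)]])
    fix x
    from T(2)[of "\<lambda>_. encode x" x] obtain t s' where "exec c (\<lambda>_. encode x) t s'" "t \<le> T x" "s' 0 = encode (f x)"
      unfolding runs_def by auto
    with exec_size[OF this(1), of 0] show "esize (f x) \<le> esize x + T x" by simp
  qed
qed

lemma poly_bounded_comp:
  assumes "poly_bounded T" "ptime f"
  shows "poly_bounded (\<lambda>x. T (f x))"
proof -
  obtain p where "\<And>y. T y \<le> poly p (esize y)" using assms(1) unfolding poly_bounded_def by blast
  then show ?thesis
    by (intro poly_bounded_mono[OF poly_bounded_poly[OF ptime_poly_bounded[OF assms(2)], of p]])
qed

text \<open>Programs see only encodings. Hence a truth value may be computed as a number, a list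
  cell as a pair, and a conjunction as a conditional.\<close>

lemma ptime_recode:
  assumes "ptime f" "\<And>x. encode (g x) = encode (f x)"
  shows "ptime g"
  using assms unfolding ptime_def by simp

lemma ptime_exp:
  assumes "poly_bounded T"
    and "\<And>b s x. s b = encode x \<Longrightarrow> eval_exp (e b) s = encode (f x) \<and> exp_cost (e b) s \<le> T x"
  shows "ptime f"
  unfolding ptime_def
proof (intro allI exI conjI impI)
  fix b :: nat and s :: state and x :: 'a
  show "poly_bounded (\<lambda>x. 1 + T x)" by (intro poly_bounded_add poly_bounded_const assms(1))
  assume "s b = encode x"
  with assms(2)[of s b x] show "runs (Assign b (e b)) s (1 + T x) (\<lambda>s'. s' b = encode (f x) \<and> (\<forall>v<b. s' v = s v))"
    by (intro runs_Assign) auto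
qed

section \<open>Closure under composition, pairing, branching and folds\<close>

lemma ptime_ident: "ptime (\<lambda>x. x)"
  by (rule ptime_exp[OF poly_bounded_esize, of Var]) simp

lemma ptime_encode: "ptime encode"
  by (rule ptime_recode[OF ptime_ident]) simp

lemma ptime_compose:
  assumes "ptime g" "ptime f"
  shows "ptime (\<lambda>x. g (f x))"
  unfolding ptime_def
proof
  fix b
  obtain cf Tf where f: "poly_bounded Tf"
    "\<And>s x. s b = encode x \<Longrightarrow> runs cf s (Tf x) (\<lambda>s'. s' b = encode (f x) \<and> (\<forall>v<b. s' v = s v))"
    by (rule ptimeE[OF assms(2), of "b"]) (rule that)
  obtain cg Tg where g: "poly_bounded Tg"
    "\<And>s x. s b = encode x \<Longrightarrow> runs cg s (Tg x) (\<lambda>s'. s' b = encode (g x) \<and> (\<forall>v<b. s' v = s v))"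
    by (rule ptimeE[OF assms(1), of "b"]) (rule that)
  have "runs (Seq cf cg) s (Tf x + Tg (f x)) (\<lambda>s'. s' b = encode (g (f x)) \<and> (\<forall>v<b. s' v = s v))"
    if "s b = encode x" for s x
    apply (rule runs_Seq[OF runs_mono[OF f(2)[of s x, OF that] order_refl] order_refl])
    apply (rule runs_mono[OF g(2)[of _ "f x"]])
      apply auto
    done
  then show "\<exists>c T. poly_bounded T \<and> (\<forall>s x. s b = encode x \<longrightarrow>
     runs c s (T x) (\<lambda>s'. s' b = encode (g (f x)) \<and> (\<forall>v<b. s' v = s v)))"
    using poly_bounded_add[OF f(1) poly_bounded_comp[OF g(1) assms(2)]] by blast
qed

text \<open>The components are computed in \<open>b + 1\<close> and \<open>b + 2\<close>. Each
  program leaves all lower variables alone, so the argument in \<open>b\<close> and the first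
  component survive.\<close>

lemma ptime_Pair:
  assumes "ptime f" "ptime g"
  shows "ptime (\<lambda>x. (f x, g x))"
  unfolding ptime_def
proof
  fix b
  obtain cf Tf where f: "poly_bounded Tf"
    "\<And>s x. s (b+1) = encode x \<Longrightarrow> runs cf s (Tf x) (\<lambda>s'. s' (b+1) = encode (f x) \<and> (\<forall>v<b+1. s' v = s v))"
    by (rule ptimeE[OF assms(1), of "b+1"]) (rule that)
  obtain cg Tg where g: "poly_bounded Tg"
    "\<And>s x. s (b+2) = encode x \<Longrightarrow> runs cg s (Tg x) (\<lambda>s'. s' (b+2) = encode (g x) \<and> (\<forall>v<b+2. s' v = s v))"
    by (rule ptimeE[OF assms(2), of "b+2"]) (rule that)
  define c where "c = Seq (Assign (b+1) (Var b)) (Seq cf (Seq (Assign (b+2) (Var b)) (Seq cg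
    (Assign b (Mk (Var (b+1)) (Var (b+2)))))))"
  define T where "T = (\<lambda>x. (1 + esize x) + (Tf x + ((1 + esize x) + (Tg x + (2 + 2 * esize (f x) + 2 * esize (g x))))))"
  have T: "poly_bounded T" unfolding T_def
    by (intro poly_bounded_add poly_bounded_mult poly_bounded_const poly_bounded_esize f(1) g(1) ptime_poly_bounded assms)
  have "runs c s (T x) (\<lambda>s'. s' b = encode (f x, g x) \<and> (\<forall>v<b. s' v = s v))"
    if sb: "s b = encode x" for s x
    unfolding c_def T_def
    apply (rule runs_Seq[OF runs_Assign order_refl])
     apply (rule runs_Seq[OF runs_mono[OF f(2) order_refl] order_refl])
      apply (simp add: sb)
     apply (rule runs_Seq[OF runs_Assign order_refl])
      apply (rule runs_Seq[OF runs_mono[OF g(2) order_refl] order_refl])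
       apply (simp add: sb)
      apply (rule runs_Assign)
       apply (auto simp: sb)
    done
  with T show "\<exists>c T. poly_bounded T \<and> (\<forall>s x. s b = encode x \<longrightarrow>
     runs c s (T x) (\<lambda>s'. s' b = encode (f x, g x) \<and> (\<forall>v<b. s' v = s v)))" by blast
qed

lemma ptime_If:
  assumes "ptime P" "ptime f" "ptime g"
  shows "ptime (\<lambda>x. if P x then f x else g x)"
  unfolding ptime_def
proof
  fix b
  obtain cP TP where P: "poly_bounded TP"
    "\<And>s x. s (b+1) = encode x \<Longrightarrow> runs cP s (TP x) (\<lambda>s'. s' (b+1) = encode (P x) \<and> (\<forall>v<b+1. s' v = s v))"
    by (rule ptimeE[OF assms(1), of "b+1"]) (rule that)
  obtain cf Tf where f: "poly_bounded Tf"
    "\<And>s x. s b = encode x \<Longrightarrow> runs cf s (Tf x) (\<lambda>s'. s' b = encode (f x) \<and> (\<forall>v<b. s' v = s v))"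
    by (rule ptimeE[OF assms(2), of "b"]) (rule that)
  obtain cg Tg where g: "poly_bounded Tg"
    "\<And>s x. s b = encode x \<Longrightarrow> runs cg s (Tg x) (\<lambda>s'. s' b = encode (g x) \<and> (\<forall>v<b. s' v = s v))"
    by (rule ptimeE[OF assms(3), of "b"]) (rule that)
  define c where "c = Seq (Assign (b+1) (Var b)) (Seq cP (Cond (Var (b+1)) cf cg))"
  define T where "T = (\<lambda>x. (1 + esize x) + (TP x + (3 + (Tf x + Tg x))))"
  have T: "poly_bounded T" unfolding T_def
    by (intro poly_bounded_add poly_bounded_mult poly_bounded_const poly_bounded_esize P(1) f(1) g(1))
  have "runs c s (T x) (\<lambda>s'. s' b = encode (if P x then f x else g x) \<and> (\<forall>v<b. s' v = s v))"
    if sb: "s b = encode x" for s x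
    unfolding c_def T_def
    apply (rule runs_Seq[OF runs_Assign order_refl])
     apply (rule runs_Seq[OF runs_mono[OF P(2) order_refl] order_refl])
      apply (simp add: sb)
     apply (rule runs_Cond[of _ _ _ "Tf x + Tg x"])
       apply (rule runs_mono[OF f(2)[of _ x]]; auto simp: sb)
      apply (rule runs_mono[OF g(2)[of _ x]]; auto simp: sb)
     apply (auto simp: sb)
    done
  with T show "\<exists>c T. poly_bounded T \<and> (\<forall>s x. s b = encode x \<longrightarrow>
     runs c s (T x) (\<lambda>s'. s' b = encode (if P x then f x else g x) \<and> (\<forall>v<b. s' v = s v)))" by blast
qed

text \<open>The accumulator must be bounded after every prefix of the list: a polynomial-time step
  alone could double its size in each round. The program keeps the argument in \<open>b\<close>, the
  remaining list in \<open>b + 1\<close>, the accumulator in \<open>b + 2\<close>, and calls the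
  step in \<open>b + 3\<close>.\<close>

lemma ptime_fold:
  assumes L: "ptime L" and I: "ptime I" and F: "ptime (\<lambda>z. F (fst z) (fst (snd z)) (snd (snd z)))"
    and bd: "poly_bounded B" "\<And>x k. esize (fold (F x) (take k (L x)) (I x)) \<le> B x"
  shows "ptime (\<lambda>x. fold (F x) (L x) (I x))"
  unfolding ptime_def
proof
  fix b
  obtain cL TL where L': "poly_bounded TL"
    "\<And>s x. s (b+1) = encode x \<Longrightarrow> runs cL s (TL x) (\<lambda>s'. s' (b+1) = encode (L x) \<and> (\<forall>v<b+1. s' v = s v))"
    by (rule ptimeE[OF L, of "b+1"]) (rule that)
  obtain cI TI where I': "poly_bounded TI"
    "\<And>s x. s (b+2) = encode x \<Longrightarrow> runs cI s (TI x) (\<lambda>s'. s' (b+2) = encode (I x) \<and> (\<forall>v<b+2. s' v = s v))"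
    by (rule ptimeE[OF I, of "b+2"]) (rule that)
  obtain cF TF where F1: "poly_bounded TF"
    "\<And>s z. s (b+3) = encode z \<Longrightarrow> runs cF s (TF z)
       (\<lambda>s'. s' (b+3) = encode (F (fst z) (fst (snd z)) (snd (snd z))) \<and> (\<forall>v<b+3. s' v = s v))"
    by (rule ptimeE[OF F, of "b+3"]) (rule that)
  have F': "runs cF s (TF (x, e, a)) (\<lambda>s'. s' (b+3) = encode (F x e a) \<and> (\<forall>v<b+3. s' v = s v))"
    if "s (b+3) = encode (x, e, a)" for s x e a
    using F1(2)[of s "(x, e, a)"] that by simp
  obtain p where p: "\<And>z. TF z \<le> poly p (esize z)"
    using F1(1) unfolding poly_bounded_def by blast
  define body where "body = Seq (Assign (b+3) (Mk (Var b) (Mk (Hd (Var (b+1))) (Var (b+2)))))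
    (Seq cF (Seq (Assign (b+2) (Var (b+3))) (Assign (b+1) (Tl (Var (b+1))))))"
  define W where "W = While (IsNode (Var (b+1))) body"
  \<comment> \<open>\<open>M\<close> bounds every value alive in the loop, and
    \<open>3 * M x + 2\<close> the triple passed to \<open>cF\<close>; \<open>K\<close> bounds the
    time of one iteration including the loop test.\<close>
  define M where "M = (\<lambda>x. esize x + esize (L x) + B x + 1)"
  define K where "K = (\<lambda>x. (4 + M x) + ((4 + 9 * M x) + (poly p (3 * M x + 2) + ((1 + M x) + (1 + 2 * M x)))))"
  \<comment> \<open>The invariant speaks of an arbitrary remaining list and accumulator. Its size
    hypothesis passes to the tail by replacing \<open>k\<close> with \<open>Suc k\<close>.\<close>
  have loop: "runs W s (length ys * K x + (3 + M x))
      (\<lambda>s'. s' (b+2) = encode (fold (F x) ys a) \<and> (\<forall>v\<le>b. s' v = s v))"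
    if "s b = encode x" "s (b+1) = encode ys" "s (b+2) = encode a" "esize ys \<le> M x"
      "\<And>k. esize (fold (F x) (take k ys) a) \<le> M x" for s x ys a
    using that
  proof (induction ys arbitrary: s a)
    case Nil
    show ?case unfolding W_def
      by (rule runs_While_False) (use Nil in auto)
  next
    case (Cons e ys)
    have a: "esize a \<le> M x" using Cons.prems(5)[of 0] by simp
    have Fa: "esize (F x e a) \<le> M x" using Cons.prems(5)[of 1] by simp
    have x: "esize x \<le> M x" by (simp add: M_def)
    have TF: "TF (x, e, a) \<le> poly p (3 * M x + 2)"
      by (rule order_trans[OF p poly_nat_mono]) (use Cons.prems(4) a x in simp)
    have IH: "runs W s' (length ys * K x + (3 + M x))
        (\<lambda>s''. s'' (b+2) = encode (fold (F x) ys (F x e a)) \<and> (\<forall>v\<le>b. s'' v = s' v))"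
      if "s' b = encode x" "s' (b+1) = encode ys" "s' (b+2) = encode (F x e a)" for s'
      using that Cons.prems(4) Cons.prems(5)[of "Suc k" for k] by (intro Cons.IH) auto
    have K: "1 + exp_cost (IsNode (Var (b+1))) s +
        ((4 + 9 * M x) + (poly p (3 * M x + 2) + ((1 + M x) + (1 + 2 * M x)))) + (length ys * K x + (3 + M x))
      \<le> length (e # ys) * K x + (3 + M x)"
      using Cons.prems(2,4) by (simp add: K_def)
    show ?case unfolding W_def
      apply (rule runs_While_True[OF _ _ K])
       apply (use Cons.prems(2) in simp)
      apply (subst (1) body_def)
      apply (rule runs_Seq[OF runs_Assign order_refl])
       apply (rule runs_Seq[OF runs_mono[OF F'[of _ x e a] TF] order_refl])
        apply (use Cons.prems(1-3) in simp)
       apply (rule runs_Seq[OF runs_Assign order_refl])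
        apply (rule runs_Assign)
         apply (rule runs_mono[OF IH[unfolded W_def] order_refl])
            apply (use Cons.prems(1-3) in auto)[4]
        apply (use Cons.prems(1-4) Fa a x in auto)
      done
  qed
  define c where "c = Seq (Assign (b+1) (Var b)) (Seq cL (Seq (Assign (b+2) (Var b)) (Seq cI
    (Seq W (Assign b (Var (b+2)))))))"
  define T where "T = (\<lambda>x. (1 + esize x) + (TL x + ((1 + esize x) + (TI x +
    ((esize (L x) * K x + (3 + M x)) + (1 + B x))))))"
  have M: "poly_bounded M" unfolding M_def
    by (intro poly_bounded_add poly_bounded_const poly_bounded_esize ptime_poly_bounded L bd(1))
  have K: "poly_bounded K" unfolding K_def
    by (intro poly_bounded_add poly_bounded_mult poly_bounded_const poly_bounded_poly M)
  have T: "poly_bounded T" unfolding T_def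
    by (intro poly_bounded_add poly_bounded_mult poly_bounded_const poly_bounded_esize
        ptime_poly_bounded M K L'(1) I'(1) L bd(1))
  have "runs c s (T x) (\<lambda>s'. s' b = encode (fold (F x) (L x) (I x)) \<and> (\<forall>v<b. s' v = s v))"
    if sb: "s b = encode x" for s x
  proof -
    have W: "runs W s' (esize (L x) * K x + (3 + M x))
        (\<lambda>s''. s'' (b+2) = encode (fold (F x) (L x) (I x)) \<and> (\<forall>v\<le>b. s'' v = s' v))"
      if "s' b = encode x" "s' (b+1) = encode (L x)" "s' (b+2) = encode (I x)" for s'
    proof (rule runs_mono[OF loop[of s' x "L x" "I x", OF that]])
      show "esize (fold (F x) (take k (L x)) (I x)) \<le> M x" for k
        using bd(2)[of x k] by (simp add: M_def)
    qed (use length_le_esize[of "L x"] in \<open>auto simp: M_def\<close>)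
    have fin: "esize (fold (F x) (L x) (I x)) \<le> B x"
      using bd(2)[of x "length (L x)"] by simp
    show ?thesis
    unfolding c_def T_def
    apply (rule runs_Seq[OF runs_Assign order_refl])
     apply (rule runs_Seq[OF runs_mono[OF L'(2) order_refl] order_refl])
      apply (simp add: sb)
     apply (rule runs_Seq[OF runs_Assign order_refl])
      apply (rule runs_Seq[OF runs_mono[OF I'(2) order_refl] order_refl])
       apply (simp add: sb)
      apply (rule runs_Seq[OF runs_mono[OF W order_refl] order_refl])
         apply (auto simp: sb)[3]
      apply (rule runs_Assign)
       apply (use fin in \<open>auto simp: sb\<close>)
    done
  qed
  with T show "\<exists>c T. poly_bounded T \<and> (\<forall>s x. s b = encode x \<longrightarrow>
     runs c s (T x) (\<lambda>s'. s' b = encode (fold (F x) (L x) (I x)) \<and> (\<forall>v<b. s' v = s v)))" by blast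
qed


section \<open>Arithmetic and list operations\<close>

text \<open>Every tree is the value of a closed expression built from \<open>Lit\<close> and
  \<open>Mk\<close>, whose cost does not depend on the state.\<close>

lemma ptime_const: "ptime (\<lambda>_. k)"
proof -
  have "\<exists>e C. \<forall>s. eval_exp e s = z \<and> exp_cost e s \<le> C" for z
  proof (induction z)
    case (Atom n)
    show ?case by (rule exI[of _ "Lit n"]) auto
  next
    case (Node z1 z2)
    then obtain e1 C1 e2 C2 where "\<forall>s. eval_exp e1 s = z1 \<and> exp_cost e1 s \<le> C1"
      "\<forall>s. eval_exp e2 s = z2 \<and> exp_cost e2 s \<le> C2" by blast
    then show ?case
      by (intro exI[of _ "Mk e1 e2"] exI[of _ "data_size (Node z1 z2) + C1 + C2"]) (simp add: add_mono)
  qed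
  then obtain e C where "\<And>s. eval_exp e s = encode k \<and> exp_cost e s \<le> C" by metis
  then show ?thesis by (intro ptime_exp[OF poly_bounded_const[of C], of "\<lambda>_. e"]) auto
qed

lemma poly_bounded_esize_mult: "poly_bounded (\<lambda>x. k * esize x)"
  by (intro poly_bounded_mult poly_bounded_const poly_bounded_esize)

lemma ptime_fst: "ptime f \<Longrightarrow> ptime (\<lambda>x. fst (f x))"
  by (rule ptime_compose[of fst, OF ptime_exp[OF poly_bounded_esize_mult[of 2], of "\<lambda>b. Hd (Var b)"]])
    auto

lemma ptime_snd: "ptime f \<Longrightarrow> ptime (\<lambda>x. snd (f x))"
  by (rule ptime_compose[of snd, OF ptime_exp[OF poly_bounded_esize_mult[of 2], of "\<lambda>b. Tl (Var b)"]])
    auto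

lemma ptime_binary:
  assumes "ptime (\<lambda>z. g (fst z) (snd z))" "ptime f1" "ptime f2"
  shows "ptime (\<lambda>x. g (f1 x) (f2 x))"
  using ptime_compose[OF assms(1) ptime_Pair[OF assms(2,3)]] by simp

lemma ptime_add: "ptime f \<Longrightarrow> ptime g \<Longrightarrow> ptime (\<lambda>x. f x + g x :: nat)"
proof (erule (1) ptime_binary[rotated])
  show "ptime (\<lambda>z :: nat \<times> nat. fst z + snd z)"
  proof (rule ptime_exp[of "\<lambda>x. 4 * esize x" "\<lambda>b. Add (Hd (Var b)) (Tl (Var b))"])
    fix b :: nat and s and x :: "nat \<times> nat"
    assume "s b = encode x"
    then show "eval_exp (Add (Hd (Var b)) (Tl (Var b))) s = encode (fst x + snd x) \<and>
       exp_cost (Add (Hd (Var b)) (Tl (Var b))) s \<le> 4 * esize x"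
      using floorlog_add_le[of "fst x" "snd x"] by auto
  qed (rule poly_bounded_esize_mult)
qed

lemma ptime_mult: "ptime f \<Longrightarrow> ptime g \<Longrightarrow> ptime (\<lambda>x. f x * g x :: nat)"
proof (erule (1) ptime_binary[rotated])
  show "ptime (\<lambda>z :: nat \<times> nat. fst z * snd z)"
  proof (rule ptime_exp[of "\<lambda>x. 4 * esize x" "\<lambda>b. Mul (Hd (Var b)) (Tl (Var b))"])
    fix b :: nat and s and x :: "nat \<times> nat"
    assume "s b = encode x"
    then show "eval_exp (Mul (Hd (Var b)) (Tl (Var b))) s = encode (fst x * snd x) \<and>
       exp_cost (Mul (Hd (Var b)) (Tl (Var b))) s \<le> 4 * esize x"
      using floorlog_mult_le[of "fst x" "snd x"] by auto
  qed (rule poly_bounded_esize_mult)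
qed

lemma ptime_diff: "ptime f \<Longrightarrow> ptime g \<Longrightarrow> ptime (\<lambda>x. f x - g x :: nat)"
proof (erule (1) ptime_binary[rotated])
  show "ptime (\<lambda>z :: nat \<times> nat. fst z - snd z)"
  proof (rule ptime_exp[of "\<lambda>x. 4 * esize x" "\<lambda>b. Sub (Hd (Var b)) (Tl (Var b))"])
    fix b :: nat and s and x :: "nat \<times> nat"
    assume "s b = encode x"
    then show "eval_exp (Sub (Hd (Var b)) (Tl (Var b))) s = encode (fst x - snd x) \<and>
       exp_cost (Sub (Hd (Var b)) (Tl (Var b))) s \<le> 4 * esize x"
      using floorlog_mono[of "fst x - snd x" "fst x" 2] by auto
  qed (rule poly_bounded_esize_mult)
qed

text \<open>With truncated subtraction, \<open>1 - (f x - g x)\<close> is the number that encodes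
  the truth value.\<close>

lemma ptime_le: "ptime f \<Longrightarrow> ptime g \<Longrightarrow> ptime (\<lambda>x. f x \<le> (g x :: nat))"
  by (rule ptime_recode[of "\<lambda>x. 1 - (f x - g x)"]) (auto intro: ptime_diff ptime_const)

lemma ptime_not: "ptime P \<Longrightarrow> ptime (\<lambda>x. \<not> P x)"
  by (rule ptime_recode[OF ptime_If[OF _ ptime_const[of False] ptime_const[of True], of P]]) auto

lemma ptime_conj: "ptime P \<Longrightarrow> ptime Q \<Longrightarrow> ptime (\<lambda>x. P x \<and> Q x)"
  by (rule ptime_recode[OF ptime_If[OF _ _ ptime_const[of False], of P Q]]) auto

lemma ptime_disj: "ptime P \<Longrightarrow> ptime Q \<Longrightarrow> ptime (\<lambda>x. P x \<or> Q x)"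
  by (rule ptime_recode[OF ptime_If[OF _ ptime_const[of True], of P Q]]) auto

lemma ptime_eq: "ptime f \<Longrightarrow> ptime g \<Longrightarrow> ptime (\<lambda>x. f x = (g x :: nat))"
  by (rule ptime_recode[of "\<lambda>x. f x \<le> g x \<and> g x \<le> f x"]) (auto intro: ptime_conj ptime_le)

lemma ptime_Suc: "ptime f \<Longrightarrow> ptime (\<lambda>x. Suc (f x))"
  using ptime_add[OF _ ptime_const[of 1], of f] by simp

lemma ptime_Cons: "ptime f \<Longrightarrow> ptime g \<Longrightarrow> ptime (\<lambda>x. f x # g x)"
  by (rule ptime_recode[of "\<lambda>x. (f x, g x)"]) (auto intro: ptime_Pair)

lemma ptime_eq_Nil: "ptime f \<Longrightarrow> ptime (\<lambda>x. f x = [])"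
proof (rule ptime_compose[of "\<lambda>xs. xs = []"])
  show "ptime (\<lambda>xs :: 'b list. xs = [])"
  proof (rule ptime_recode[OF ptime_not])
    show "ptime (\<lambda>xs :: 'b list. xs \<noteq> [])"
    proof (rule ptime_exp[of "\<lambda>x. 3 * esize x" "\<lambda>b. IsNode (Var b)"])
      fix b :: nat and s and xs :: "'b list"
      assume "s b = encode xs"
      then show "eval_exp (IsNode (Var b)) s = encode (xs \<noteq> []) \<and>
        exp_cost (IsNode (Var b)) s \<le> 3 * esize xs"
        by (cases xs) auto
    qed (rule poly_bounded_esize_mult)
  qed auto
qed

text \<open>If each step adds an amount that depends on the argument only, the accumulator stays
  polynomial because the list is no longer than its encoding.\<close>

lemma ptime_fold_additive:
  assumes L: "ptime L" and I: "ptime I" and F: "ptime (\<lambda>z. F (fst z) (fst (snd z)) (snd (snd z)))"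
    and H: "poly_bounded H" "\<And>x e a. e \<in> set (L x) \<Longrightarrow> esize (F x e a) \<le> esize a + H x"
  shows "ptime (\<lambda>x. fold (F x) (L x) (I x))"
proof (rule ptime_fold[OF L I F])
  show "poly_bounded (\<lambda>x. esize (I x) + esize (L x) * H x)"
    by (intro poly_bounded_add poly_bounded_mult ptime_poly_bounded L I H)
  fix x k
  have "esize (fold (F x) xs a) \<le> esize a + length xs * H x" if "set xs \<subseteq> set (L x)" for xs a
    using that
  proof (induction xs arbitrary: a)
    case (Cons e xs)
    have "esize (fold (F x) xs (F x e a)) \<le> esize (F x e a) + length xs * H x"
      using Cons.prems by (intro Cons.IH) auto
    also have "esize (F x e a) \<le> esize a + H x" using Cons.prems by (intro H(2)) auto
    finally show ?case by simp
  qed simp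
  then have "esize (fold (F x) (take k (L x)) (I x)) \<le> esize (I x) + length (take k (L x)) * H x"
    by (metis set_take_subset)
  also have "\<dots> \<le> esize (I x) + esize (L x) * H x"
    using length_le_esize[of "L x"] by (intro add_mono mult_mono) auto
  finally show "esize (fold (F x) (take k (L x)) (I x)) \<le> esize (I x) + esize (L x) * H x" .
qed

text \<open>A member is smaller than its list, so a bound in terms of \<open>(x, e)\<close> becomes
  one in terms of \<open>x\<close> alone, as required for the increments in
  \<open>ptime_fold_additive\<close>.\<close>

lemma poly_bounded_member:
  assumes "ptime (\<lambda>z. f (fst z) (snd z))" "ptime L"
  obtains H where "poly_bounded H" "\<And>x e. e \<in> set (L x) \<Longrightarrow> esize (f x e) \<le> H x"
proof -
  obtain p where p: "\<And>z. esize (f (fst z) (snd z)) \<le> poly p (esize z)"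
    using ptime_poly_bounded[OF assms(1)] unfolding poly_bounded_def by blast
  show ?thesis
  proof (rule that)
    show "poly_bounded (\<lambda>x. poly p (1 + esize x + esize (L x)))"
      by (intro poly_bounded_poly poly_bounded_add poly_bounded_const poly_bounded_esize ptime_poly_bounded assms)
    fix x e assume e: "e \<in> set (L x)"
    have "esize (f x e) \<le> poly p (esize (x, e))" using p[of "(x, e)"] by simp
    also have "\<dots> \<le> poly p (1 + esize x + esize (L x))"
      using esize_member[OF e] by (intro poly_nat_mono) simp
    finally show "esize (f x e) \<le> poly p (1 + esize x + esize (L x))" .
  qed
qed

text \<open>Reshapes a function of argument and element to the triple of argument, element and
  accumulator that the fold rules expect.\<close>

lemma ptime_fold_arg:
  assumes "ptime (\<lambda>z. f (fst z) (snd z))"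
  shows "ptime (\<lambda>z. f (fst z) (fst (snd z)))"
  using ptime_compose[OF assms, of "\<lambda>z. (fst z, fst (snd z))"]
    ptime_Pair[OF ptime_fst[OF ptime_ident] ptime_fst[OF ptime_snd[OF ptime_ident]]] by simp

named_theorems ptime_intros

lemmas [ptime_intros] = ptime_ident ptime_const ptime_fst ptime_snd ptime_Pair ptime_If
  ptime_Suc ptime_add ptime_mult ptime_diff ptime_le ptime_eq ptime_not ptime_conj ptime_disj
  ptime_Cons ptime_eq_Nil

lemma ptime_rev [ptime_intros]: "ptime L \<Longrightarrow> ptime (\<lambda>x. rev (L x))"
proof -
  assume L: "ptime L"
  have "ptime (\<lambda>x. fold (#) (L x) [])"
  proof (rule ptime_fold_additive[of _ _ _ "\<lambda>x. 1 + esize (L x)"])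
    show "esize (e # a) \<le> esize a + (1 + esize (L x))" if "e \<in> set (L x)" for x e a
      using esize_member[OF that] by simp
  qed (intro ptime_intros L poly_bounded_add poly_bounded_const ptime_poly_bounded)+
  then show ?thesis by (simp add: rev_conv_fold)
qed

lemma ptime_append [ptime_intros]: "ptime L \<Longrightarrow> ptime M \<Longrightarrow> ptime (\<lambda>x. L x @ M x)"
proof -
  assume L: "ptime L" and M: "ptime M"
  have "ptime (\<lambda>x. fold (#) (rev (L x)) (M x))"
  proof (rule ptime_fold_additive[of _ _ _ "\<lambda>x. 1 + esize (L x)"])
    show "esize (e # a) \<le> esize a + (1 + esize (L x))" if "e \<in> set (rev (L x))" for x e a
      using esize_member[of e "L x"] that by simp
  qed (intro ptime_intros L M poly_bounded_add poly_bounded_const ptime_poly_bounded)+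
  then show ?thesis by (simp add: fold_Cons_rev)
qed

lemma ptime_filter [ptime_intros]:
  assumes P: "ptime (\<lambda>z. P (fst z) (snd z))" and L: "ptime L"
  shows "ptime (\<lambda>x. filter (P x) (L x))"
proof -
  have "ptime (\<lambda>x. fold (\<lambda>e a. if P x e then e # a else a) (L x) [])"
  proof (rule ptime_fold_additive[of _ _ _ "\<lambda>x. 1 + esize (L x)"])
    show "ptime (\<lambda>z. if P (fst z) (fst (snd z)) then fst (snd z) # snd (snd z) else snd (snd z))"
      by (intro ptime_intros ptime_fold_arg[OF P])
    show "esize (if P x e then e # a else a) \<le> esize a + (1 + esize (L x))" if "e \<in> set (L x)" for x e a
      using esize_member[OF that] by simp
  qed (intro ptime_intros L poly_bounded_add poly_bounded_const ptime_poly_bounded)+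
  moreover have "fold (\<lambda>e a. if p e then e # a else a) xs a = rev (filter p xs) @ a" for p xs and a :: "'b list"
    by (induction xs arbitrary: a) auto
  ultimately have "ptime (\<lambda>x. rev (filter (P x) (L x)))" by simp
  from ptime_rev[OF this] show ?thesis by simp
qed

lemma ptime_map [ptime_intros]:
  fixes f :: "'a::enc \<Rightarrow> 'b::enc \<Rightarrow> 'c::enc"
  assumes f: "ptime (\<lambda>z. f (fst z) (snd z))" and L: "ptime L"
  shows "ptime (\<lambda>x. map (f x) (L x))"
proof -
  obtain H where H: "poly_bounded H" "\<And>x e. e \<in> set (L x) \<Longrightarrow> esize (f x e) \<le> H x"
    by (rule poly_bounded_member[OF f L]) (rule that)
  have "ptime (\<lambda>x. fold (\<lambda>e a. f x e # a) (L x) [])"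
  proof (rule ptime_fold_additive[of _ _ _ "\<lambda>x. 1 + H x"])
    show "ptime (\<lambda>z. f (fst z) (fst (snd z)) # snd (snd z))"
      by (intro ptime_intros ptime_fold_arg[OF f])
    show "esize (f x e # a) \<le> esize a + (1 + H x)" if "e \<in> set (L x)" for x e a
      using H(2)[OF that] by simp
  qed (intro L ptime_intros poly_bounded_add poly_bounded_const H)+
  moreover have "fold (\<lambda>e a. g e # a) xs a = rev (map g xs) @ a" for g :: "'b \<Rightarrow> 'c" and xs a
    by (induction xs arbitrary: a) auto
  ultimately have "ptime (\<lambda>x. rev (map (f x) (L x)))" by simp
  from ptime_rev[OF this] show ?thesis by simp
qed

lemma ptime_sum_list [ptime_intros]:
  assumes f: "ptime (\<lambda>z. f (fst z) (snd z))" and L: "ptime L"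
  shows "ptime (\<lambda>x. sum_list (map (f x) (L x)) :: nat)"
proof -
  obtain H where H: "poly_bounded H" "\<And>x e. e \<in> set (L x) \<Longrightarrow> esize (f x e) \<le> H x"
    by (rule poly_bounded_member[OF f L]) (rule that)
  have "ptime (\<lambda>x. fold (\<lambda>e a. a + f x e) (L x) 0)"
  proof (rule ptime_fold_additive[OF _ _ _ H(1)])
    show "ptime (\<lambda>z. snd (snd z) + f (fst z) (fst (snd z)))"
      by (intro ptime_intros ptime_fold_arg[OF f])
    show "esize (a + f x e) \<le> esize a + H x" if "e \<in> set (L x)" for x e a
      using H(2)[OF that] floorlog_add_le[of a "f x e"] by simp
  qed (intro L ptime_intros)+
  moreover have "fold (\<lambda>e a. a + g e) xs a = a + sum_list (map g xs)" for g :: "'b \<Rightarrow> nat" and xs a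
    by (induction xs arbitrary: a) auto
  ultimately show ?thesis by simp
qed

text \<open>The product may be exponentially large, but its binary length is at most the sum of the
  lengths of the factors.\<close>

lemma ptime_prod_list [ptime_intros]:
  assumes f: "ptime (\<lambda>z. f (fst z) (snd z))" and L: "ptime L"
  shows "ptime (\<lambda>x. prod_list (map (f x) (L x)) :: nat)"
proof -
  obtain H where H: "poly_bounded H" "\<And>x e. e \<in> set (L x) \<Longrightarrow> esize (f x e) \<le> H x"
    by (rule poly_bounded_member[OF f L]) (rule that)
  have "ptime (\<lambda>x. fold (\<lambda>e a. a * f x e) (L x) 1)"
  proof (rule ptime_fold_additive[OF _ _ _ H(1)])
    show "ptime (\<lambda>z. snd (snd z) * f (fst z) (fst (snd z)))"
      by (intro ptime_intros ptime_fold_arg[OF f])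
    show "esize (a * f x e) \<le> esize a + H x" if "e \<in> set (L x)" for x e a
      using H(2)[OF that] floorlog_mult_le[of a "f x e"] by simp
  qed (intro L ptime_intros)+
  moreover have "fold (\<lambda>e a. a * g e) xs a = a * prod_list (map g xs)" for g :: "'b \<Rightarrow> nat" and xs a
    by (induction xs arbitrary: a) auto
  ultimately show ?thesis by simp
qed

lemma ptime_length [ptime_intros]: "ptime L \<Longrightarrow> ptime (\<lambda>x. length (L x))"
  using ptime_sum_list[of "\<lambda>_ _. 1" L, OF ptime_const] by (simp add: sum_list_triv)

lemma ptime_Bex_set [ptime_intros]:
  assumes P: "ptime (\<lambda>z. P (fst z) (snd z))" and L: "ptime L"
  shows "ptime (\<lambda>x. \<exists>e\<in>set (L x). P x e)"
  using ptime_not[OF ptime_eq_Nil[OF ptime_filter[OF P L]]] by (simp add: filter_empty_conv)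

lemma ptime_Ball_set [ptime_intros]:
  assumes P: "ptime (\<lambda>z. P (fst z) (snd z))" and L: "ptime L"
  shows "ptime (\<lambda>x. \<forall>e\<in>set (L x). P x e)"
  using ptime_not[OF ptime_Bex_set[OF ptime_not[OF P] L]] by simp

lemma ptime_member [ptime_intros]:
  assumes "ptime f" "ptime L"
  shows "ptime (\<lambda>x. f x \<in> set (L x :: nat list))"
proof -
  have "ptime (\<lambda>x. \<exists>e\<in>set (L x). e = f x)"
    by (intro ptime_intros assms ptime_compose[OF assms(1) ptime_fst[OF ptime_ident]])
  then show ?thesis by simp
qed

text \<open>Indexing as a fold whose accumulator carries the running position and the value found so
  far, initially the default.\<close>

lemma nth_default_fold:
  "nth_default d xs i = snd (fold (\<lambda>e a. (fst a + 1, if fst a = i then e else snd a)) xs (0, d))"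
proof -
  have "fold (\<lambda>e a. (fst a + 1, if fst a = i then e else snd a)) xs (j, a) =
     (j + length xs, if j \<le> i \<and> i < j + length xs then xs ! (i - j) else a)" for j a
    by (induction xs arbitrary: j a) (auto simp: nth_Cons' Suc_diff_Suc)
  then show ?thesis by (simp add: nth_default_def)
qed

lemma ptime_nth_default [ptime_intros]:
  assumes d: "ptime d" and L: "ptime L" and i: "ptime i"
  shows "ptime (\<lambda>x. nth_default (d x) (L x) (i x))"
  unfolding nth_default_fold
proof (rule ptime_snd, rule ptime_fold_additive[of _ _ _ "\<lambda>x. 2 + esize (L x)"])
  show "ptime (\<lambda>z. (fst (snd (snd z)) + 1,
      if fst (snd (snd z)) = i (fst z) then fst (snd z) else snd (snd (snd z))))"
    by (intro ptime_intros ptime_compose[OF i ptime_fst[OF ptime_ident]])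
  show "esize (fst a + 1, if fst a = i x then e else snd a) \<le> esize a + (2 + esize (L x))"
    if "e \<in> set (L x)" for x e a
    using esize_member[OF that] floorlog_add_le[of "fst a" 1] by auto
qed (intro L d ptime_intros poly_bounded_add poly_bounded_const ptime_poly_bounded)+


section \<open>The algorithm\<close>

text \<open>The last component encodes to the end marker of the list that forms the input.\<close>

type_synonym input = "bool list list \<times> nat \<times> nat \<times> (nat \<times> nat) list \<times> nat"

definition adj :: "input \<Rightarrow> nat \<Rightarrow> nat \<Rightarrow> bool" where
  "adj x u v = nth_default False (nth_default [] (fst x) u) v"

text \<open>The decreasing order is the one that arises by repeatedly consing the current length of
  the accumulator, which is how \<open>ptime_verts\<close> computes the list.\<close>

definition verts :: "input \<Rightarrow> nat list" where
  "verts x = rev [0..<length (fst x)]"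

text \<open>The costs scaled to integers by the product of all denominators; multiplying by the other
  denominators avoids a division.\<close>

definition weight :: "input \<Rightarrow> nat \<Rightarrow> nat" where
  "weight x v = fst (nth_default (0, 0) (fst (snd (snd (snd x)))) v) *
     prod_list (map (\<lambda>u. snd (nth_default (0, 0) (fst (snd (snd (snd x)))) u)) (filter (\<lambda>u. u \<noteq> v) (verts x)))"

text \<open>The measure \<open>\<mu>\<close>, formed with the scaled costs.\<close>

definition charge :: "input \<Rightarrow> nat \<Rightarrow> nat" where
  "charge x v = length (verts x) * weight x v + sum_list (map (weight x) (verts x))"

definition boundary :: "(nat \<Rightarrow> nat \<Rightarrow> bool) \<Rightarrow> nat list \<Rightarrow> nat list \<Rightarrow> nat list \<Rightarrow> nat list" where
  "boundary a V B S = filter (\<lambda>u. u \<in> set B \<and> u \<notin> set S \<and> (\<exists>s\<in>set S. a s u)) V"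

definition grow_step ::
  "(nat \<Rightarrow> nat \<Rightarrow> bool) \<Rightarrow> nat list \<Rightarrow> (nat \<Rightarrow> nat) \<Rightarrow> nat \<Rightarrow> nat list \<Rightarrow> nat list \<Rightarrow> nat list" where
  "grow_step a V \<mu> l B S =
     (if 2 * l * sum_list (map \<mu> (boundary a V B S)) \<le> sum_list (map \<mu> S) then S
      else filter (\<lambda>u. u \<in> set S \<or> u \<in> set (boundary a V B S)) V)"

text \<open>In \<open>grow\<close>, \<open>tree\<close> and \<open>sep_final\<close> the list folded over is only a counter. Its length suffices
  because a ball gains a vertex in every step, the ports have distance at most \<open>2 * n\<close>, and the
  steps of the algorithm decrease a potential that starts at \<open>2 * n\<close>.\<close>

definition grow ::
  "(nat \<Rightarrow> nat \<Rightarrow> bool) \<Rightarrow> nat list \<Rightarrow> (nat \<Rightarrow> nat) \<Rightarrow> nat \<Rightarrow> nat list \<Rightarrow> nat \<Rightarrow> nat list" where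
  "grow a V \<mu> l B v = fold (\<lambda>_. grow_step a V \<mu> l B) V (filter (\<lambda>u. u = v) V)"

text \<open>An entry \<open>(u, P)\<close> of the table consists of a vertex reached from the root and the vertex set \<open>P\<close>
  of a path to it.\<close>

definition tree_step ::
  "(nat \<Rightarrow> nat \<Rightarrow> bool) \<Rightarrow> nat list \<Rightarrow> nat list \<Rightarrow> (nat \<times> nat list) list \<Rightarrow> (nat \<times> nat list) list" where
  "tree_step a V B T = T @
     map (\<lambda>u. (u, filter (\<lambda>w. w = u \<or> w \<in> set (nth_default [] (map snd (filter (\<lambda>e. a u (fst e)) T)) 0)) V))
       (filter (\<lambda>u. u \<in> set B \<and> u \<notin> set (map fst T) \<and> (\<exists>e\<in>set T. a u (fst e))) V)"

definition tree ::
  "(nat \<Rightarrow> nat \<Rightarrow> bool) \<Rightarrow> nat list \<Rightarrow> nat list \<Rightarrow> nat \<Rightarrow> (nat \<times> nat list) list" where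
  "tree a V B r = fold (\<lambda>_. tree_step a V B) (V @ V) [(r, filter (\<lambda>w. w = r) V)]"

definition tree_path :: "(nat \<times> nat list) list \<Rightarrow> nat \<Rightarrow> nat list" where
  "tree_path T u = nth_default [] (map snd (filter (\<lambda>e. fst e = u) T)) 0"

definition ports :: "(nat \<Rightarrow> nat \<Rightarrow> bool) \<Rightarrow> nat list \<Rightarrow> nat list list \<Rightarrow> nat list" where
  "ports a B W = map (\<lambda>X. nth_default 0 (filter (\<lambda>u. \<exists>x\<in>set X. a x u) B) 0) W"

text \<open>The root is the first port. If the model is still empty there are no ports; then the
  head of \<open>B\<close> is taken and the branch set is a single vertex.\<close>

definition branch_set ::
  "(nat \<Rightarrow> nat \<Rightarrow> bool) \<Rightarrow> nat list \<Rightarrow> nat list \<Rightarrow> nat list \<Rightarrow> nat list" where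
  "branch_set a V B ps = (let r = nth_default 0 (ps @ B) 0 in
     filter (\<lambda>w. w = r \<or> (\<exists>p\<in>set ps. w \<in> set (tree_path (tree a V B r) p))) V)"

type_synonym sep_state = "nat list \<times> nat list \<times> nat list list"

definition cut_step ::
  "(nat \<Rightarrow> nat \<Rightarrow> bool) \<Rightarrow> nat list \<Rightarrow> nat list \<Rightarrow> sep_state \<Rightarrow> sep_state" where
  "cut_step a V S = (\<lambda>(B, C, W).
     (filter (\<lambda>u. u \<notin> set S \<and> u \<notin> set (boundary a V B S)) B, boundary a V B S @ C, W))"

definition extend_step ::
  "nat list \<Rightarrow> sep_state \<Rightarrow> sep_state" where
  "extend_step X = (\<lambda>(B, C, W). (filter (\<lambda>u. u \<notin> set X) B, C, X # W))"

definition small_ports ::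
  "(nat \<Rightarrow> nat \<Rightarrow> bool) \<Rightarrow> nat list \<Rightarrow> (nat \<Rightarrow> nat) \<Rightarrow> nat \<Rightarrow> nat list \<Rightarrow> nat list list \<Rightarrow> nat list" where
  "small_ports a V \<mu> l B W = filter (\<lambda>v. 2 * length (grow a V \<mu> l B v) \<le> length B) (ports a B W)"

text \<open>The order of the tests matters: members without a neighbour in \<open>B\<close> are
  dropped before ports are used, so every remaining member has a genuine port and the default in
  \<open>ports\<close> is never taken.\<close>

definition sep_step ::
  "(nat \<Rightarrow> nat \<Rightarrow> bool) \<Rightarrow> nat list \<Rightarrow> (nat \<Rightarrow> nat) \<Rightarrow> nat \<Rightarrow> nat \<Rightarrow> sep_state \<Rightarrow> sep_state" where
  "sep_step a V \<mu> l m0 = (\<lambda>(B, C, W).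
     if 3 * length B \<le> 2 * length V \<or> length W = m0 then (B, C, W)
     else if \<exists>X\<in>set W. \<forall>x\<in>set X. \<forall>u\<in>set B. \<not> a x u
       then (B, C, filter (\<lambda>X. \<exists>x\<in>set X. \<exists>u\<in>set B. a x u) W)
     else if small_ports a V \<mu> l B W = [] then extend_step (branch_set a V B (ports a B W)) (B, C, W)
     else cut_step a V (grow a V \<mu> l B (nth_default 0 (small_ports a V \<mu> l B W) 0)) (B, C, W))"

definition sep_final ::
  "(nat \<Rightarrow> nat \<Rightarrow> bool) \<Rightarrow> nat list \<Rightarrow> (nat \<Rightarrow> nat) \<Rightarrow> nat \<Rightarrow> nat \<Rightarrow> sep_state" where
  "sep_final a V \<mu> l m0 = fold (\<lambda>_. sep_step a V \<mu> l m0) (V @ V) (V, [], [])"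

definition sep_result :: "nat list \<Rightarrow> nat \<Rightarrow> sep_state \<Rightarrow> data" where
  "sep_result V m0 = (\<lambda>(B, C, W). if length W = m0 then encode (0 :: nat, W)
     else encode (1 :: nat, C, filter (\<lambda>u. \<exists>X\<in>set W. u \<in> set X) V))"

definition separate :: "input \<Rightarrow> data" where
  "separate x = sep_result (verts x) (fst (snd (snd x)))
     (sep_final (adj x) (verts x) (charge x) (fst (snd x)) (fst (snd (snd x))))"


section \<open>Polynomial running time of the algorithm\<close>

lemma ptime_ternary:
  assumes "ptime (\<lambda>z. g (fst z) (fst (snd z)) (snd (snd z)))" "ptime f1" "ptime f2" "ptime f3"
  shows "ptime (\<lambda>x. g (f1 x) (f2 x) (f3 x))"
  using ptime_compose[OF assms(1) ptime_Pair[OF assms(2) ptime_Pair[OF assms(3,4)]]] by simp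

lemma esize_list_le:
  "(\<And>e. e \<in> set xs \<Longrightarrow> esize e \<le> h) \<Longrightarrow> esize xs \<le> 2 + length xs * (h + 1)"
  by (induction xs) (force simp: algebra_simps)+

lemma ptime_adj [ptime_intros]:
  "ptime X \<Longrightarrow> ptime u \<Longrightarrow> ptime v \<Longrightarrow> ptime (\<lambda>z. adj (X z) (u z) (v z))"
  unfolding adj_def by (intro ptime_intros)

text \<open>\<open>ptime_fold_additive\<close> asks for an increment valid for all accumulators, but
  here the consed number is the length of the accumulator itself. So \<open>ptime_fold\<close> is
  applied directly, with the explicit value after each prefix.\<close>

lemma ptime_verts [ptime_intros]:
  assumes "ptime X"
  shows "ptime (\<lambda>z. verts (X z))"
proof (rule ptime_compose[OF _ assms])
  have fold_eq: "fold (\<lambda>_ a. length a # a) xs [] = rev [0..<length xs]" for xs :: "bool list list"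
    by (induction xs rule: rev_induct) auto
  have "ptime (\<lambda>x :: input. fold (\<lambda>_ a. length a # a) (fst x) [])"
  proof (rule ptime_fold[of _ _ _ "\<lambda>x. 2 + esize (fst x) * (1 + esize (fst x) + 1)"])
    fix x :: input and k
    have "esize e \<le> 1 + esize (fst x)" if "e < length (fst x)" for e
    proof -
      have "floorlog 2 e \<le> e" by (intro floorlog_leI) auto
      then show ?thesis using that length_le_esize[of "fst x"] by simp
    qed
    then have "esize (rev [0..<min (length (fst x)) k]) \<le> 2 + length (rev [0..<min (length (fst x)) k]) * (1 + esize (fst x) + 1)"
      by (intro esize_list_le) auto
    also have "\<dots> \<le> 2 + esize (fst x) * (1 + esize (fst x) + 1)"
      using length_le_esize[of "fst x"] by (intro add_mono mult_mono) auto
    finally show "esize (fold (\<lambda>_ a. length a # a) (take k (fst x)) []) \<le> 2 + esize (fst x) * (1 + esize (fst x) + 1)"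
      unfolding fold_eq by simp
  qed (intro ptime_intros poly_bounded_add poly_bounded_mult poly_bounded_const ptime_poly_bounded)+
  then show "ptime verts" by (simp add: verts_def[abs_def] fold_eq)
qed

lemma ptime_weight [ptime_intros]:
  "ptime X \<Longrightarrow> ptime v \<Longrightarrow> ptime (\<lambda>z. weight (X z) (v z))"
  by (rule ptime_binary[of weight]) (unfold weight_def, intro ptime_intros)

lemma ptime_charge [ptime_intros]:
  "ptime X \<Longrightarrow> ptime v \<Longrightarrow> ptime (\<lambda>z. charge (X z) (v z))"
  by (rule ptime_binary[of charge]) (unfold charge_def, intro ptime_intros)

lemma ptime_boundary [ptime_intros]:
  "ptime X \<Longrightarrow> ptime B \<Longrightarrow> ptime S \<Longrightarrow> ptime (\<lambda>z. boundary (adj (X z)) (verts (X z)) (B z) (S z))"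
  by (rule ptime_ternary[of "\<lambda>x. boundary (adj x) (verts x)"]) (unfold boundary_def, intro ptime_intros)

lemma ptime_grow_step [ptime_intros]:
  "ptime X \<Longrightarrow> ptime B \<Longrightarrow> ptime S \<Longrightarrow>
    ptime (\<lambda>z. grow_step (adj (X z)) (verts (X z)) (charge (X z)) (fst (snd (X z))) (B z) (S z))"
  by (rule ptime_ternary[of "\<lambda>x. grow_step (adj x) (verts x) (charge x) (fst (snd x))"])
    (unfold grow_step_def, intro ptime_intros)

lemma ptime_grow [ptime_intros]:
  "ptime X \<Longrightarrow> ptime B \<Longrightarrow> ptime v \<Longrightarrow>
    ptime (\<lambda>z. grow (adj (X z)) (verts (X z)) (charge (X z)) (fst (snd (X z))) (B z) (v z))"
proof (rule ptime_ternary[of "\<lambda>x. grow (adj x) (verts x) (charge x) (fst (snd x))"])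
  show "ptime (\<lambda>z :: input \<times> nat list \<times> nat. grow (adj (fst z)) (verts (fst z)) (charge (fst z)) (fst (snd (fst z))) (fst (snd z)) (snd (snd z)))"
    unfolding grow_def
  proof (rule ptime_fold_additive[of _ _ _ "\<lambda>z. esize (verts (fst z))"])
    fix z :: "input \<times> nat list \<times> nat" and S
    show "esize (grow_step (adj (fst z)) (verts (fst z)) (charge (fst z)) (fst (snd (fst z))) (fst (snd z)) S)
        \<le> esize S + esize (verts (fst z))"
      unfolding grow_step_def by (auto intro: trans_le_add2 esize_filter)
  qed (intro ptime_intros ptime_poly_bounded)+
qed

lemma ptime_tree_step [ptime_intros]:
  "ptime X \<Longrightarrow> ptime B \<Longrightarrow> ptime T \<Longrightarrow> ptime (\<lambda>z. tree_step (adj (X z)) (verts (X z)) (B z) (T z))"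
  by (rule ptime_ternary[of "\<lambda>x. tree_step (adj x) (verts x)"])
    (unfold tree_step_def, intro ptime_intros)

text \<open>A step appends at most one entry per vertex, and each entry consists of a vertex and a
  sublist of \<open>V\<close>; the increment is thus quadratic in the size of \<open>V\<close>,
  whatever the table.\<close>

lemma ptime_tree [ptime_intros]:
  "ptime X \<Longrightarrow> ptime B \<Longrightarrow> ptime r \<Longrightarrow> ptime (\<lambda>z. tree (adj (X z)) (verts (X z)) (B z) (r z))"
proof (rule ptime_ternary[of "\<lambda>x. tree (adj x) (verts x)"])
  show "ptime (\<lambda>z :: input \<times> nat list \<times> nat. tree (adj (fst z)) (verts (fst z)) (fst (snd z)) (snd (snd z)))"
    unfolding tree_def
  proof (rule ptime_fold_additive[of _ _ _ "\<lambda>z. 2 + esize (verts (fst z)) * (1 + 2 * esize (verts (fst z)) + 1)"])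
    fix z :: "input \<times> nat list \<times> nat" and T :: "(nat \<times> nat list) list"
    let ?V = "verts (fst z)"
    define news where "news = filter (\<lambda>u. u \<in> set (fst (snd z)) \<and> u \<notin> set (map fst T) \<and> (\<exists>e\<in>set T. adj (fst z) u (fst e))) ?V"
    define f where "f = (\<lambda>u. (u, filter (\<lambda>w. w = u \<or> w \<in> set (nth_default [] (map snd (filter (\<lambda>e. adj (fst z) u (fst e)) T)) 0)) ?V))"
    have "esize (map f news) \<le> 2 + length (map f news) * (1 + 2 * esize ?V + 1)"
    proof (rule esize_list_le)
      fix e assume "e \<in> set (map f news)"
      then obtain u where u: "u \<in> set ?V" "e = f u" by (auto simp: news_def)
      have "esize u \<le> esize ?V" using esize_member[OF u(1)] by simp
      moreover have "esize (snd (f u)) \<le> esize ?V" by (simp add: f_def esize_filter)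
      moreover have "fst (f u) = u" by (simp add: f_def)
      ultimately show "esize e \<le> 1 + 2 * esize ?V" by (simp add: u(2))
    qed
    also have "\<dots> \<le> 2 + esize ?V * (1 + 2 * esize ?V + 1)"
      using length_le_esize[of ?V] length_filter_le[of _ ?V]
      by (intro add_mono mult_mono) (auto simp: news_def intro: order_trans[OF length_filter_le])
    finally show "esize (tree_step (adj (fst z)) ?V (fst (snd z)) T)
        \<le> esize T + (2 + esize ?V * (1 + 2 * esize ?V + 1))"
      unfolding tree_step_def news_def[symmetric] f_def[symmetric]
      by (intro order_trans[OF esize_append] add_mono order_refl)
  qed (intro ptime_intros poly_bounded_add poly_bounded_mult poly_bounded_const ptime_poly_bounded)+
qed

lemma ptime_ports [ptime_intros]:
  "ptime X \<Longrightarrow> ptime B \<Longrightarrow> ptime W \<Longrightarrow> ptime (\<lambda>z. ports (adj (X z)) (B z) (W z))"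
  by (rule ptime_ternary[of "\<lambda>x. ports (adj x)"]) (unfold ports_def, intro ptime_intros)

lemma ptime_tree_path [ptime_intros]:
  "ptime T \<Longrightarrow> ptime u \<Longrightarrow> ptime (\<lambda>z. tree_path (T z) (u z))"
  by (rule ptime_binary[of tree_path]) (unfold tree_path_def, intro ptime_intros)

lemma ptime_branch_set [ptime_intros]:
  "ptime X \<Longrightarrow> ptime B \<Longrightarrow> ptime P \<Longrightarrow> ptime (\<lambda>z. branch_set (adj (X z)) (verts (X z)) (B z) (P z))"
  by (rule ptime_ternary[of "\<lambda>x. branch_set (adj x) (verts x)"])
    (unfold branch_set_def Let_def, intro ptime_intros)

lemma ptime_small_ports [ptime_intros]:
  "ptime X \<Longrightarrow> ptime B \<Longrightarrow> ptime W \<Longrightarrow>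
    ptime (\<lambda>z. small_ports (adj (X z)) (verts (X z)) (charge (X z)) (fst (snd (X z))) (B z) (W z))"
  by (rule ptime_ternary[of "\<lambda>x. small_ports (adj x) (verts x) (charge x) (fst (snd x))"])
    (unfold small_ports_def, intro ptime_intros)

lemma ptime_sep_step:
  "ptime X \<Longrightarrow> ptime st \<Longrightarrow>
    ptime (\<lambda>z. sep_step (adj (X z)) (verts (X z)) (charge (X z)) (fst (snd (X z))) (fst (snd (snd (X z)))) (st z))"
  by (rule ptime_binary[of "\<lambda>x. sep_step (adj x) (verts x) (charge x) (fst (snd x)) (fst (snd (snd x)))"])
    (unfold sep_step_def cut_step_def extend_step_def case_prod_beta fst_conv snd_conv, intro ptime_intros)

text \<open>Filtering only shrinks \<open>B\<close> and \<open>W\<close>, and a step adds at most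
  one sublist of \<open>V\<close>, either in front of \<open>C\<close> or as a new member of
  \<open>W\<close>.\<close>

lemma esize_sep_step: "esize (sep_step a V \<mu> l m0 st) \<le> esize st + (1 + esize V)"
proof -
  obtain B C W where st: "st = (B, C, W)" by (cases st)
  have "esize (extend_step (branch_set a V B (ports a B W)) st) \<le> esize st + (1 + esize V)"
    unfolding extend_step_def st branch_set_def Let_def
    using esize_filter[of _ B] esize_filter[of _ V] by (simp add: add_mono)
  moreover have "esize (cut_step a V S st) \<le> esize st + (1 + esize V)" for S
  proof -
    have "esize (boundary a V B S @ C) \<le> esize V + esize C"
      unfolding boundary_def by (intro order_trans[OF esize_append] add_mono esize_filter order_refl)
    then show ?thesis unfolding cut_step_def st
      using esize_filter[of "\<lambda>u. u \<notin> set S \<and> u \<notin> set (boundary a V B S)" B] by simp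
  qed
  ultimately show ?thesis
    unfolding sep_step_def st
    using esize_filter[of "\<lambda>X. \<exists>x\<in>set X. \<exists>u\<in>set B. a x u" W] by simp
qed

lemma ptime_sep_final [ptime_intros]:
  "ptime X \<Longrightarrow> ptime (\<lambda>z. sep_final (adj (X z)) (verts (X z)) (charge (X z)) (fst (snd (X z))) (fst (snd (snd (X z)))))"
proof (rule ptime_compose[of "\<lambda>x. sep_final (adj x) (verts x) (charge x) (fst (snd x)) (fst (snd (snd x)))"])
  show "ptime (\<lambda>x. sep_final (adj x) (verts x) (charge x) (fst (snd x)) (fst (snd (snd x))))"
    unfolding sep_final_def
  proof (rule ptime_fold_additive[of _ _ _ "\<lambda>x. 1 + esize (verts x)"])
    show "esize (sep_step (adj x) (verts x) (charge x) (fst (snd x)) (fst (snd (snd x))) st)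
        \<le> esize st + (1 + esize (verts x))" for x and st
      by (rule esize_sep_step)
  qed (intro ptime_intros ptime_sep_step poly_bounded_add poly_bounded_const ptime_poly_bounded)+
qed

lemma ptime_separate: "ptime separate"
  unfolding separate_def[abs_def] sep_result_def case_prod_beta
  by (intro ptime_intros ptime_compose[OF ptime_encode])


section \<open>Graphs\<close>

lemma fold_const: "fold (\<lambda>_. f) xs = f ^^ length xs"
  by (induction xs) (auto simp: fun_eq_iff funpow_swap1)

lemma relpow_sym: "sym R \<Longrightarrow> (x, y) \<in> R ^^ j \<Longrightarrow> (y, x) \<in> R ^^ j"
proof (induction j arbitrary: y)
  case (Suc j)
  then obtain z where "(x, z) \<in> R ^^ j" "(z, y) \<in> R" by auto
  then show ?case using Suc by (metis relpow_Suc_I2 symD)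
qed auto

lemma relpow_mono: "R \<subseteq> S \<Longrightarrow> R ^^ j \<subseteq> (S ^^ j :: 'a rel)"
  by (induction j) auto

text \<open>The radius is a minimum over centres, so one good centre \<open>r\<close>
  suffices.\<close>

lemma radius_le:
  assumes "finite X" "r \<in> X" "\<And>y. y \<in> X \<Longrightarrow> \<exists>j\<le>D. (r, y) \<in> (Restr E X) ^^ j"
  shows "radius E X \<le> D"
proof -
  have "distance (Restr E X) r y \<le> D" if "y \<in> X" for y
    using assms(3)[OF that] unfolding distance_def by (meson Least_le order_trans)
  then have "(MAX y\<in>X. distance (Restr E X) r y) \<le> D"
    using assms(1,2) by (subst Max_le_iff) auto
  moreover have "radius E X \<le> (MAX y\<in>X. distance (Restr E X) r y)"
    unfolding radius_def using assms(1,2) by (intro Min_le) auto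
  ultimately show ?thesis by simp
qed

lemma induces_connected_rootI:
  assumes "sym E" "r \<in> X" "\<And>y. y \<in> X \<Longrightarrow> \<exists>j. (r, y) \<in> (Restr E X) ^^ j"
  shows "induces_connected E X"
proof -
  have "sym (Restr E X)" using assms(1) by (auto simp: sym_def)
  then have "(y, r) \<in> (Restr E X)\<^sup>*" if "y \<in> X" for y
    using assms(3)[OF that] by (meson relpow_sym relpow_imp_rtrancl)
  moreover have "(r, y) \<in> (Restr E X)\<^sup>*" if "y \<in> X" for y
    using assms(3)[OF that] by (meson relpow_imp_rtrancl)
  ultimately show ?thesis
    unfolding induces_connected_def using assms(2) by (auto intro: rtrancl_trans)
qed

text \<open>The maximum in \<open>omega\<close> is over a finite set, since the members of a model
  are distinct subsets of \<open>V\<close>; without finiteness \<open>Max\<close> would say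
  nothing.\<close>

lemma le_omega:
  assumes "finite V" "clique_model V E m W" "has_depth E d W"
  shows "m \<le> omega V E d"
proof -
  have "{m. \<exists>W. clique_model V E m W \<and> has_depth E d W} \<subseteq> {..card (Pow V)}"
  proof safe
    fix m W assume "clique_model V E m W"
    then have "W \<subseteq> Pow V" "card W = m" by (auto simp: clique_model_def)
    then show "m \<le> card (Pow V)" using card_mono[of "Pow V" W] assms(1) by simp
  qed
  then have "finite {m. \<exists>W. clique_model V E m W \<and> has_depth E d W}"
    by (rule finite_subset) simp
  then show ?thesis unfolding omega_def using assms(2,3) by (intro Max_ge) auto
qed

lemma clique_model_subset:
  "clique_model V E m W \<Longrightarrow> W' \<subseteq> W \<Longrightarrow> card W' = m' \<Longrightarrow> clique_model V E m' W'"
  unfolding clique_model_def by (meson finite_subset pairwise_subset subset_iff)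

lemma clique_model_insert:
  assumes W: "clique_model V E m W" and E: "sym E"
    and X: "X \<subseteq> V" "induces_connected E X" "X \<inter> \<Union>W = {}"
    and adj: "\<And>Y. Y \<in> W \<Longrightarrow> \<exists>y\<in>Y. \<exists>x\<in>X. (y, x) \<in> E"
  shows "clique_model V E (Suc m) (insert X W)"
proof -
  have "X \<notin> W" using X unfolding induces_connected_def by blast
  moreover have "\<exists>x\<in>X. \<exists>y\<in>Y. (x, y) \<in> E" if "Y \<in> W" for Y
    using adj[OF that] E by (meson symD)
  ultimately show ?thesis
    using W X adj unfolding clique_model_def pairwise_insert disjnt_def by auto
qed

text \<open>No edge runs between \<open>R\<close> and \<open>B\<close>, so a path that starts in one
  of them stays there.\<close>

lemma components_subset:
  assumes "sym E" "\<And>r b. r \<in> R \<Longrightarrow> b \<in> B \<Longrightarrow> (r, b) \<notin> E" "K \<in> components E (R \<union> B)"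
  shows "K \<subseteq> R \<or> K \<subseteq> B"
proof -
  let ?F = "Restr E (R \<union> B)"
  obtain x where x: "x \<in> R \<union> B" "K = ?F\<^sup>* `` {x}"
    using assms(3) unfolding components_def by (auto elim: quotientE)
  have 1: "y \<in> R" if "(x, y) \<in> ?F\<^sup>*" "x \<in> R" for y
    using that by induction (use assms(2) in auto)
  have 2: "y \<in> B" if "(x, y) \<in> ?F\<^sup>*" "x \<in> B" for y
    using that by induction (use assms(1,2) in \<open>auto dest: symD\<close>)
  show ?thesis using x 1 2 by auto
qed

text \<open>By Bernoulli's inequality \<open>2 * l\<close> steps at least double the measure, and
  \<open>floorlog 2 n + 1\<close> doublings exceed the factor \<open>2 * n\<close>.\<close>

lemma growth_steps_le:
  fixes w M :: real
  assumes "1 \<le> l" "0 < w" "(1 + 1 / (2 * real l)) ^ i * w \<le> M" "M \<le> 2 * real n * w"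
  shows "i \<le> 2 * l * (floorlog 2 n + 1)"
proof (rule ccontr)
  let ?r = "1 + 1 / (2 * real l)"
  assume "\<not> ?thesis"
  then have i: "2 * l * (floorlog 2 n + 1) \<le> i" by simp
  have "n < 2 ^ floorlog 2 n" by (intro floorlog_leD[OF order_refl]) simp
  then have "2 * real n < 2 ^ (floorlog 2 n + 1)" by simp
  also have "(2::real) \<le> ?r ^ (2 * l)"
    using Bernoulli_inequality[of "1 / (2 * real l)" "2 * l"] assms(1) by (simp add: field_simps)
  then have "2 ^ (floorlog 2 n + 1) \<le> (?r ^ (2 * l)) ^ (floorlog 2 n + 1)"
    by (intro power_mono) auto
  also have "\<dots> = ?r ^ (2 * l * (floorlog 2 n + 1))" by (simp only: power_mult)
  also have "\<dots> \<le> ?r ^ i" by (intro power_increasing i) auto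
  finally have "2 * real n * w < ?r ^ i * w" using assms(2) by simp
  with assms(3,4) show False by simp
qed


section \<open>Balls and branch sets\<close>

lemma nth_default_filter_witness:
  "filter P xs \<noteq> [] \<Longrightarrow> \<exists>x\<in>set xs. P x \<and> nth_default c (map g (filter P xs)) 0 = g x"
  using nth_mem[of 0 "filter P xs"] by (auto simp: nth_default_def)

text \<open>The bound on the radius of a ball that \<open>growth_steps_le\<close> provides.\<close>

definition half_depth :: "nat \<Rightarrow> nat \<Rightarrow> nat" where
  "half_depth l n = 2 * l * (floorlog 2 n + 1)"

text \<open>Centres of two meeting balls have distance at most \<open>2 * half_depth l n\<close>.
  The extra one counts vertices instead of edges, so that \<open>depth\<close> also bounds the
  number of vertices of a path between ports.\<close>

definition depth :: "nat \<Rightarrow> nat \<Rightarrow> nat" where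
  "depth l n = 2 * half_depth l n + 1"

text \<open>Ball growing needs only the two inequalities between \<open>\<mu>\<close> and
  \<open>w\<close>: every vertex weighs at least \<open>w\<close>, and all together at most
  \<open>2 * n * w\<close>. The value \<open>w = 0\<close> is allowed, since all costs may
  vanish.\<close>

locale separation =
  fixes n :: nat and E :: "nat rel" and V :: "nat list" and l m0 :: nat and \<mu> :: "nat \<Rightarrow> nat" and w :: nat
  assumes graph: "simple_graph {..<n} E"
    and distinct_V: "distinct V" and set_V: "set V = {..<n}"
    and l: "1 \<le> l"
    and \<mu>_lower: "\<And>v. v < n \<Longrightarrow> w \<le> \<mu> v" and \<mu>_total: "sum \<mu> {..<n} \<le> 2 * n * w"
begin

abbreviation a :: "nat \<Rightarrow> nat \<Rightarrow> bool" where "a u v \<equiv> (u, v) \<in> E"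
abbreviation k :: nat where "k \<equiv> half_depth l n"
abbreviation d :: nat where "d \<equiv> depth l n"

lemma length_V: "length V = n"
  using distinct_card[OF distinct_V] set_V by simp

lemma sym_E: "sym E" and E_subset: "E \<subseteq> {..<n} \<times> {..<n}"
  using graph unfolding simple_graph_def by auto

lemma length_distinct_le: "distinct S \<Longrightarrow> set S \<subseteq> set B \<Longrightarrow> length S \<le> length B"
  by (metis card_length card_mono distinct_card List.finite_set order_trans)

lemma sum_\<mu>_le: "distinct S \<Longrightarrow> set S \<subseteq> set V \<Longrightarrow> sum_list (map \<mu> S) \<le> 2 * n * w"
  using order_trans[OF sum_mono2[of "{..<n}" "set S" \<mu>] \<mu>_total] set_V
  by (simp add: sum_list_distinct_conv_sum_set)

lemma set_boundary:
  "set B \<subseteq> set V \<Longrightarrow> set (boundary a V B S) = {u \<in> set B. u \<notin> set S \<and> (\<exists>s\<in>set S. (s, u) \<in> E)}"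
  unfolding boundary_def by auto

lemma distinct_boundary: "distinct (boundary a V B S)"
  unfolding boundary_def using distinct_V by simp

text \<open>Here \<open>j\<close> counts the steps in which the ball really grew. Each such step
  extends the radius by at most one, multiplies the measure by at least
  \<open>1 + 1 / (2 * real l)\<close> and adds a vertex; once the boundary is light, nothing changes
  any more.\<close>

lemma grow_funpow:
  assumes B: "set B \<subseteq> set V" and v: "v \<in> set B"
  defines "f \<equiv> grow_step a V \<mu> l B"
  shows "\<exists>j\<le>i. let S = (f ^^ i) (filter (\<lambda>u. u = v) V) in
     v \<in> set S \<and> set S \<subseteq> set B \<and> distinct S \<and> (\<forall>u\<in>set S. \<exists>j'\<le>j. (v, u) \<in> (Restr E (set B)) ^^ j') \<and>
     (1 + 1 / (2 * real l)) ^ j * real w \<le> real (sum_list (map \<mu> S)) \<and> j < length S \<and> j \<le> k \<and>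
     (j = i \<or> 2 * l * sum_list (map \<mu> (boundary a V B S)) \<le> sum_list (map \<mu> S))"
proof (induction i)
  case 0
  have set0: "set (filter (\<lambda>u. u = v) V) = {v}" using B v by auto
  moreover have dist0: "distinct (filter (\<lambda>u. u = v) V)" using distinct_V by simp
  moreover have "sum_list (map \<mu> (filter (\<lambda>u. u = v) V)) = \<mu> v"
    using set0 dist0 by (simp add: sum_list_distinct_conv_sum_set)
  moreover have "length (filter (\<lambda>u. u = v) V) = 1"
    using distinct_card[OF dist0] set0 by simp
  moreover have "w \<le> \<mu> v" using \<mu>_lower[of v] B v set_V by auto
  ultimately show ?case using v by (simp add: Let_def)
next
  case (Suc i)
  define S where "S = (f ^^ i) (filter (\<lambda>u. u = v) V)"
  define N where "N = boundary a V B S"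
  obtain j where j: "j \<le> i" "v \<in> set S" "set S \<subseteq> set B" "distinct S"
    "\<forall>u\<in>set S. \<exists>j'\<le>j. (v, u) \<in> (Restr E (set B)) ^^ j'"
    "(1 + 1 / (2 * real l)) ^ j * real w \<le> real (sum_list (map \<mu> S))" "j < length S" "j \<le> k"
    "j = i \<or> 2 * l * sum_list (map \<mu> N) \<le> sum_list (map \<mu> S)"
    using Suc.IH unfolding Let_def S_def[symmetric] N_def[symmetric] by (elim exE conjE) (rule that)
  have step: "(f ^^ Suc i) (filter (\<lambda>u. u = v) V) = f S" by (simp add: S_def)
  show ?case
  proof (cases "2 * l * sum_list (map \<mu> N) \<le> sum_list (map \<mu> S)")
    case True
    then have "f S = S" by (simp add: f_def grow_step_def N_def)
    then show ?thesis
      unfolding step Let_def using j True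
      by (intro exI[of _ j]) (simp add: N_def[symmetric])
  next
    case False
    then have ji: "j = i" using j(9) by simp
    have fS: "f S = filter (\<lambda>u. u \<in> set S \<or> u \<in> set N) V"
      using False by (simp add: f_def grow_step_def N_def)
    have N: "set N = {u \<in> set B. u \<notin> set S \<and> (\<exists>s\<in>set S. (s, u) \<in> E)}" "distinct N"
      unfolding N_def using set_boundary[OF B] distinct_boundary by auto
    have set_fS: "set (f S) = set S \<union> set N" and dist_fS: "distinct (f S)"
      unfolding fS using j(3) B N(1) distinct_V by auto
    have sum_fS: "sum_list (map \<mu> (f S)) = sum_list (map \<mu> S) + sum_list (map \<mu> N)"
    proof -
      have "set S \<inter> set N = {}" using N(1) by auto
      then show ?thesis using dist_fS j(4) N(2) set_fS
        by (simp add: sum_list_distinct_conv_sum_set sum.union_disjoint)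
    qed
    have N_pos: "0 < sum_list (map \<mu> N)"
      using False by (intro gr0I notI) (simp only: mult_0_right le0 not_True_eq_False)
    then have "N \<noteq> []" by (intro notI) simp
    moreover have "length (f S) = length S + length N"
    proof -
      have "set S \<inter> set N = {}" using N(1) by auto
      then show ?thesis
        using card_Un_disjoint[of "set S" "set N"]
        by (simp add: set_fS distinct_card[OF dist_fS, symmetric] distinct_card[OF j(4), symmetric]
            distinct_card[OF N(2), symmetric])
    qed
    ultimately have len: "Suc i < length (f S)" using j(7) ji by (cases N) auto
    have sub: "set (f S) \<subseteq> set B" using set_fS j(3) N(1) by auto
    have upper: "sum_list (map \<mu> (f S)) \<le> 2 * n * w"
      using sum_\<mu>_le[OF dist_fS] sub B by auto
    define x y where "x = sum_list (map \<mu> S)" and "y = sum_list (map \<mu> N)"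
    \<comment> \<open>The boundary is heavy, so adding \<open>y\<close> increases the measure by at
      least \<open>x / (2 * l)\<close>.\<close>
    have "real x \<le> real (2 * l * y)" using False unfolding x_def y_def by (simp only: of_nat_le_iff)
    then have "(1 + 1 / (2 * real l)) * real x \<le> real (x + y)"
      using l by (simp add: field_simps)
    then have "(1 + 1 / (2 * real l)) * real (sum_list (map \<mu> S)) \<le> real (sum_list (map \<mu> (f S)))"
      unfolding sum_fS x_def y_def .
    then have lower: "(1 + 1 / (2 * real l)) ^ Suc i * real w \<le> real (sum_list (map \<mu> (f S)))"
      using mult_left_mono[OF j(6), of "1 + 1 / (2 * real l)"] ji by (simp add: mult.assoc)
    \<comment> \<open>A heavy boundary has positive measure, which excludes \<open>w = 0\<close> and
      makes \<open>growth_steps_le\<close> applicable.\<close>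
    have "0 < 2 * n * w" using upper sum_fS N_pos by linarith
    then have "0 < w" by simp
    moreover have "real (sum_list (map \<mu> (f S))) \<le> 2 * real n * real w"
      using of_nat_mono[OF upper, where 'a = real] by (simp only: of_nat_mult of_nat_numeral)
    ultimately have Suc_k: "Suc i \<le> k"
      unfolding half_depth_def by (intro growth_steps_le[OF l _ lower]) simp_all
    have reach: "\<forall>u\<in>set (f S). \<exists>j'\<le>Suc i. (v, u) \<in> (Restr E (set B)) ^^ j'"
    proof
      fix u assume u: "u \<in> set (f S)"
      show "\<exists>j'\<le>Suc i. (v, u) \<in> (Restr E (set B)) ^^ j'"
      proof (cases "u \<in> set S")
        case True
        then obtain j' where "j' \<le> i" "(v, u) \<in> (Restr E (set B)) ^^ j'" using j(5) ji by blast
        then show ?thesis by (intro exI[of _ j']) simp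
      next
        case False
        then have "u \<in> set N" using u set_fS by simp
        then obtain s where s: "s \<in> set S" "(s, u) \<in> E" "u \<in> set B" using N(1) by auto
        then obtain j' where "j' \<le> i" "(v, s) \<in> (Restr E (set B)) ^^ j'" using j(5) ji by auto
        then show ?thesis using s j(3) by (intro exI[of _ "Suc j'"]) auto
      qed
    qed
    show ?thesis
      unfolding step Let_def
      by (rule exI[of _ "Suc i"], intro conjI order_refl disjI1 refl lower len sub dist_fS reach Suc_k)
        (use j(2) set_fS in simp)
  qed
qed

text \<open>After \<open>n\<close> steps the growth has stopped, since otherwise the ball would have
  more than \<open>n\<close> vertices. Both radius bounds are kept: \<open>k\<close> yields the
  depth, while \<open>n\<close> ensures that the counter of \<open>tree\<close> is long
  enough.\<close>

lemma grow_props: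
  assumes B: "set B \<subseteq> set V" and v: "v \<in> set B"
  defines "S \<equiv> grow a V \<mu> l B v"
  shows "v \<in> set S" "set S \<subseteq> set B" "distinct S"
    "u \<in> set S \<Longrightarrow> \<exists>j\<le>min k n. (v, u) \<in> (Restr E (set B)) ^^ j"
    "2 * l * sum_list (map \<mu> (boundary a V B S)) \<le> sum_list (map \<mu> S)"
proof -
  have S: "S = (grow_step a V \<mu> l B ^^ n) (filter (\<lambda>u. u = v) V)"
    unfolding S_def grow_def fold_const length_V ..
  obtain j where j: "j \<le> n" "v \<in> set S" "set S \<subseteq> set B" "distinct S"
    "\<forall>u\<in>set S. \<exists>j'\<le>j. (v, u) \<in> (Restr E (set B)) ^^ j'" "j < length S" "j \<le> k"
    "j = n \<or> 2 * l * sum_list (map \<mu> (boundary a V B S)) \<le> sum_list (map \<mu> S)"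
    using grow_funpow[OF B v, of n] unfolding Let_def S[symmetric] by (elim exE conjE) (rule that)
  have "length S \<le> n" using length_distinct_le[OF j(4) order_trans[OF j(3) B]] length_V by simp
  then have "j \<noteq> n" using j(6) by simp
  then show "2 * l * sum_list (map \<mu> (boundary a V B S)) \<le> sum_list (map \<mu> S)"
    using j(8) by simp
  show "v \<in> set S" by (rule j(2))
  show "set S \<subseteq> set B" by (rule j(3))
  show "distinct S" by (rule j(4))
  assume "u \<in> set S"
  with j(5) have "\<exists>j'\<le>j. (v, u) \<in> (Restr E (set B)) ^^ j'" by (rule bspec)
  then obtain j' where "j' \<le> j" "(v, u) \<in> (Restr E (set B)) ^^ j'" by (elim exE conjE)
  then show "\<exists>j\<le>min k n. (v, u) \<in> (Restr E (set B)) ^^ j"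
    using j(1,7) by (intro exI[of _ j'] conjI) simp_all
qed

section \<open>Tables of paths and the branch sets built from them\<close>

text \<open>What a path from \<open>r\<close> to \<open>u\<close> with at most \<open>i\<close>
  edges contributes to a branch set. Distances are measured inside \<open>P\<close>, so they remain
  valid in every union containing \<open>P\<close>.\<close>

definition good_path :: "nat list \<Rightarrow> nat \<Rightarrow> nat \<Rightarrow> nat \<Rightarrow> nat list \<Rightarrow> bool" where
  "good_path B r i u P \<longleftrightarrow> u \<in> set P \<and> r \<in> set P \<and> set P \<subseteq> set B \<and> length P \<le> Suc i \<and>
     (\<forall>x\<in>set P. \<exists>j\<le>i. (r, x) \<in> (Restr E (set P)) ^^ j)"

lemma good_path_mono: "good_path B r i u P \<Longrightarrow> i \<le> i' \<Longrightarrow> good_path B r i' u P"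
  unfolding good_path_def by (meson Suc_le_mono order_trans)

text \<open>A new vertex inherits the path of the first table entry adjacent to it, extended by
  itself; symmetry of \<open>E\<close> turns this adjacency into the last edge of the path.\<close>

lemma tree_step_good:
  assumes B: "set B \<subseteq> set V"
    and T: "\<And>e. e \<in> set T \<Longrightarrow> good_path B r i (fst e) (snd e)"
    and e: "e \<in> set (tree_step a V B T)"
  shows "good_path B r (Suc i) (fst e) (snd e)"
proof (cases "e \<in> set T")
  case True
  then show ?thesis using good_path_mono[OF T] by simp
next
  case False
  define Q where "Q = nth_default [] (map snd (filter (\<lambda>e'. a (fst e) (fst e')) T)) 0"
  from False e have
    "e \<in> (\<lambda>u. (u, filter (\<lambda>w. w = u \<or> w \<in> set (nth_default [] (map snd (filter (\<lambda>e. a u (fst e)) T)) 0)) V)) `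
       {u \<in> set V. u \<in> set B \<and> u \<notin> set (map fst T) \<and> (\<exists>e\<in>set T. a u (fst e))}"
    unfolding tree_step_def by simp
  then have u: "fst e \<in> set B" "fst e \<in> set V" "\<exists>e'\<in>set T. a (fst e) (fst e')"
    and P: "snd e = filter (\<lambda>w. w = fst e \<or> w \<in> set Q) V"
    unfolding Q_def by (elim imageE; simp)+
  from u(3) have "filter (\<lambda>e'. a (fst e) (fst e')) T \<noteq> []" by (auto simp: filter_empty_conv)
  then obtain e' where e': "e' \<in> set T" "a (fst e) (fst e')" "Q = snd e'"
    unfolding Q_def using nth_default_filter_witness[of "\<lambda>e'. a (fst e) (fst e')" T "[]" snd] by blast
  have Q: "fst e' \<in> set Q" "r \<in> set Q" "set Q \<subseteq> set B" "length Q \<le> Suc i"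
    "\<forall>x\<in>set Q. \<exists>j\<le>i. (r, x) \<in> (Restr E (set Q)) ^^ j"
    using T[OF e'(1)] unfolding good_path_def e'(3) by auto
  have set_P: "set (snd e) = insert (fst e) (set Q)" unfolding P using u Q(3) B by auto
  have dist_P: "distinct (snd e)" unfolding P using distinct_V by simp
  have "length (snd e) = card (insert (fst e) (set Q))" using distinct_card[OF dist_P] set_P by simp
  also have "\<dots> \<le> Suc (length Q)" using card_length[of Q] by (auto simp: card_insert_if)
  finally have len: "length (snd e) \<le> Suc (Suc i)" using Q(4) by simp
  have mono: "(Restr E (set Q)) ^^ j \<subseteq> (Restr E (set (snd e))) ^^ j" for j
    unfolding set_P by (intro relpow_mono) auto
  have "\<exists>j\<le>Suc i. (r, x) \<in> (Restr E (set (snd e))) ^^ j" if "x \<in> set (snd e)" for x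
  proof (cases "x \<in> set Q")
    case True
    then show ?thesis using Q(5) mono by (meson le_SucI subsetD)
  next
    case False
    then have x: "x = fst e" using that set_P by auto
    obtain j where j: "j \<le> i" "(r, fst e') \<in> (Restr E (set Q)) ^^ j" using Q(1,5) by blast
    have "(fst e', x) \<in> Restr E (set (snd e))"
      using e'(2) sym_E Q(1) set_P x by (auto dest: symD)
    then show ?thesis using j mono[of j] by (intro exI[of _ "Suc j"]) auto
  qed
  then show ?thesis unfolding good_path_def using set_P Q u len by auto
qed

text \<open>New entries are appended and the lookup takes the first match, so a path once recorded
  never changes.\<close>

lemma tree_path_step:
  "u \<in> fst ` set T \<Longrightarrow> tree_path (tree_step a V B T) u = tree_path T u"
proof -
  assume "u \<in> fst ` set T"
  then have "filter (\<lambda>e. fst e = u) T \<noteq> []" by (auto simp: filter_empty_conv)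
  then show ?thesis unfolding tree_path_def tree_step_def by (simp add: nth_default_def nth_append)
qed

lemma keys_tree_step: "fst ` set (tree_step a V B T) =
    fst ` set T \<union> {u \<in> set V. u \<in> set B \<and> u \<notin> fst ` set T \<and> (\<exists>y\<in>fst ` set T. a u y)}"
  unfolding tree_step_def by (simp add: image_Un image_image)

text \<open>A vertex reached by a walk of \<open>i\<close> edges has an entry by stage
  \<open>i\<close>, entries of stage \<open>i\<close> use at most \<open>i\<close> edges, and later
  stages leave the path unchanged.\<close>

lemma tree_path_good:
  assumes B: "set B \<subseteq> set V" and r: "r \<in> set B"
    and u: "(r, u) \<in> (Restr E (set B)) ^^ i" and i: "i \<le> 2 * n"
  shows "good_path B r i u (tree_path (tree a V B r) u)"
proof -
  define T where "T = (\<lambda>i. (tree_step a V B ^^ i) [(r, filter (\<lambda>w. w = r) V)])"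
  have T_Suc: "T (Suc i) = tree_step a V B (T i)" for i by (simp add: T_def)
  have good: "\<forall>e\<in>set (T i). good_path B r i (fst e) (snd e)" for i
  proof (induction i)
    case 0
    have "set (filter (\<lambda>w. w = r) V) = {r}" using r B by auto
    moreover have "length (filter (\<lambda>w. w = r) V) = 1"
      using distinct_card[OF distinct_filter[OF distinct_V], of "\<lambda>w. w = r"] calculation by simp
    ultimately show ?case using r by (auto simp: T_def good_path_def)
  next
    case (Suc i)
    then show ?case unfolding T_Suc using tree_step_good[OF B] by blast
  qed
  have reach: "u \<in> fst ` set (T i)" using u
  proof (induction i arbitrary: u)
    case 0
    then show ?case by (simp add: T_def)
  next
    case (Suc i)
    then obtain y where "(r, y) \<in> (Restr E (set B)) ^^ i" "(y, u) \<in> E" "u \<in> set B" by auto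
    with Suc.IH have y: "y \<in> fst ` set (T i)" "(y, u) \<in> E" "u \<in> set B" by blast+
    then have "(u, y) \<in> E" using sym_E by (auto dest: symD)
    then show ?case unfolding T_Suc keys_tree_step using y B by blast
  qed
  have keys: "u \<in> fst ` set (T (i + j))" for j
    by (induction j) (use reach keys_tree_step in \<open>simp_all add: T_Suc\<close>)
  have stable: "tree_path (T (i + j)) u = tree_path (T i) u" for j
    by (induction j) (auto simp: T_Suc tree_path_step[OF keys])
  have "tree a V B r = T (2 * n)"
    unfolding tree_def T_def fold_const by (simp add: length_V mult_2)
  then have path: "tree_path (tree a V B r) u = tree_path (T i) u"
    using stable[of "2 * n - i"] i by simp
  have "filter (\<lambda>e. fst e = u) (T i) \<noteq> []" using reach by (auto simp: filter_empty_conv)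
  then obtain e where "e \<in> set (T i)" "fst e = u" "tree_path (T i) u = snd e"
    unfolding tree_path_def using nth_default_filter_witness[of "\<lambda>e. fst e = u" "T i" "[]" snd] by blast
  then show ?thesis using good[of i] path by auto
qed

text \<open>The set is the union of paths from one root to all ports. Each path has at most
  \<open>2 * k\<close> edges, hence the radius bound, and at most \<open>2 * k + 1 = d\<close>
  vertices, hence the size bound.\<close>

lemma branch_set_props:
  assumes B: "set B \<subseteq> set V" "B \<noteq> []" and ps: "set ps \<subseteq> set B"
    and near: "\<And>p q. p \<in> set ps \<Longrightarrow> q \<in> set ps \<Longrightarrow>
      \<exists>j\<le>min (2 * k) (2 * n). (p, q) \<in> (Restr E (set B)) ^^ j"
  defines "X \<equiv> branch_set a V B ps"
  shows "X \<noteq> []" "distinct X" "set X \<subseteq> set B" "set ps \<subseteq> set X" "induces_connected E (set X)"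
    "radius E (set X) \<le> d" "length X \<le> Suc (length ps) * d"
proof -
  define r where "r = nth_default 0 (ps @ B) 0"
  define P where "P = (\<lambda>p. tree_path (tree a V B r) p)"
  have r: "r = hd (ps @ B)" unfolding r_def nth_default_def using B(2) by (simp add: hd_conv_nth)
  then have rB: "r \<in> set B" using ps B(2) by (cases ps) auto
  have P: "good_path B r (2 * k) p (P p)" if "p \<in> set ps" for p
  proof -
    \<comment> \<open>Since there is a port, the root is itself a port, and \<open>near\<close>
      applies to the pair \<open>r\<close>, \<open>p\<close>.\<close>
    have "r \<in> set ps" using that r by (cases ps) auto
    from near[OF this that] obtain j where "j \<le> min (2 * k) (2 * n)" "(r, p) \<in> (Restr E (set B)) ^^ j"
      by (elim exE conjE)
    then show ?thesis
      unfolding P_def using good_path_mono[OF tree_path_good[OF B(1) rB]] by simp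
  qed
  have X: "X = filter (\<lambda>w. w = r \<or> (\<exists>p\<in>set ps. w \<in> set (P p))) V"
    unfolding X_def branch_set_def Let_def r_def P_def ..
  have P': "p \<in> set (P p)" "set (P p) \<subseteq> set B" "length (P p) \<le> d"
    "\<forall>x\<in>set (P p). \<exists>j\<le>2 * k. (r, x) \<in> (Restr E (set (P p))) ^^ j" if "p \<in> set ps" for p
    using P[OF that] unfolding good_path_def depth_def by simp_all
  then have set_X: "set X = insert r (\<Union>p\<in>set ps. set (P p))" unfolding X using rB B(1) by fastforce
  show dist: "distinct X" unfolding X using distinct_V by simp
  show "X \<noteq> []" using set_X by auto
  show "set X \<subseteq> set B" unfolding set_X using rB P'(2) by blast
  show "set ps \<subseteq> set X" unfolding set_X using P'(1) by blast
  have reach: "\<exists>j\<le>2 * k. (r, x) \<in> (Restr E (set X)) ^^ j" if x: "x \<in> set X" for x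
  proof (cases "x = r")
    case False
    then obtain p where p: "p \<in> set ps" "x \<in> set (P p)" using x set_X by auto
    from P'(4)[OF p(1)] p(2) have "\<exists>j\<le>2 * k. (r, x) \<in> (Restr E (set (P p))) ^^ j" by (rule bspec)
    then obtain j where "j \<le> 2 * k" "(r, x) \<in> (Restr E (set (P p))) ^^ j" by (elim exE conjE)
    moreover have "(Restr E (set (P p))) ^^ j \<subseteq> (Restr E (set X)) ^^ j"
      using set_X p(1) by (intro relpow_mono) auto
    ultimately show ?thesis by (intro exI[of _ j] conjI) (simp, rule subsetD)
  qed (intro exI[of _ 0], simp)
  have rX: "r \<in> set X" using set_X by simp
  show "induces_connected E (set X)"
    using reach by (intro induces_connected_rootI[OF sym_E rX]) (meson reach)
  have "radius E (set X) \<le> 2 * k" by (intro radius_le[OF _ rX reach]) auto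
  then show "radius E (set X) \<le> d" by (simp add: depth_def)
  have "length X = card (set X)" using distinct_card[OF dist] by simp
  also have "\<dots> \<le> Suc (card (\<Union>p\<in>set ps. set (P p)))"
    unfolding set_X by (simp add: card_insert_if)
  also have "card (\<Union>p\<in>set ps. set (P p)) \<le> (\<Sum>p\<in>set ps. card (set (P p)))"
    by (rule card_UN_le) simp
  also have "\<dots> \<le> (\<Sum>p\<in>set ps. d)"
  proof (rule sum_mono)
    fix p assume "p \<in> set ps"
    then show "card (set (P p)) \<le> d" using P'(3) card_length[of "P p"] by (meson order_trans)
  qed
  also have "\<dots> \<le> length ps * d" using card_length[of ps] by simp
  \<comment> \<open>The single vertex counted for the root is absorbed because \<open>d\<close> is
    at least one; without ports it is the whole set.\<close>
  finally show "length X \<le> Suc (length ps) * d" by (simp add: depth_def)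
qed

end


section \<open>The invariant\<close>

context separation
begin

definition supp :: "nat list list \<Rightarrow> nat set" where "supp W = \<Union> (set ` set W)"

definition rest :: "nat list \<Rightarrow> nat list \<Rightarrow> nat list list \<Rightarrow> nat set" where
  "rest B C W = {..<n} - set B - set C - supp W"

text \<open>The cap by \<open>omega\<close> is what the second outcome demands; it implies the
  \<open>m0\<close>-bound demanded by the first.\<close>

definition bound :: nat where "bound = min m0 (omega {..<n} E d) * d"

text \<open>Distinctness is required of \<open>map set W\<close> rather than \<open>W\<close>,
  because different lists may represent the same vertex set and the output must enumerate the sets
  without repetition.\<close>

definition model_inv :: "nat list list \<Rightarrow> bool" where
  "model_inv W \<longleftrightarrow> distinct (map set W) \<and> (\<forall>X\<in>set W. distinct X \<and> length X \<le> bound) \<and>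
     clique_model {..<n} E (length W) (set ` set W) \<and> has_depth E d (set ` set W) \<and> length W \<le> m0"

definition sep_inv :: "nat list \<Rightarrow> nat list \<Rightarrow> nat list list \<Rightarrow> bool" where
  "sep_inv B C W \<longleftrightarrow> distinct B \<and> distinct C \<and> set B \<subseteq> {..<n} \<and> set C \<subseteq> {..<n} \<and>
     set B \<inter> set C = {} \<and> set B \<inter> supp W = {} \<and> set C \<inter> supp W = {} \<and> model_inv W \<and>
     (\<forall>u\<in>rest B C W. \<forall>b\<in>set B. (u, b) \<notin> E) \<and> 3 * card (rest B C W) \<le> 2 * n \<and>
     2 * l * sum \<mu> (set C) \<le> sum \<mu> (rest B C W)"

lemma sep_invD:
  assumes "sep_inv B C W"
  shows "distinct B" "distinct C" "set B \<subseteq> {..<n}" "set C \<subseteq> {..<n}" "set B \<inter> set C = {}"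
    "set B \<inter> supp W = {}" "set C \<inter> supp W = {}" "model_inv W"
    "u \<in> rest B C W \<Longrightarrow> b \<in> set B \<Longrightarrow> (u, b) \<notin> E" "3 * card (rest B C W) \<le> 2 * n"
    "2 * l * sum \<mu> (set C) \<le> sum \<mu> (rest B C W)"
  using assms unfolding sep_inv_def by simp_all

lemma sep_invI:
  assumes "distinct B" "distinct C" "set B \<subseteq> {..<n}" "set C \<subseteq> {..<n}" "set B \<inter> set C = {}"
    "set B \<inter> supp W = {}" "set C \<inter> supp W = {}" "model_inv W"
    "\<And>u b. u \<in> rest B C W \<Longrightarrow> b \<in> set B \<Longrightarrow> (u, b) \<notin> E" "3 * card (rest B C W) \<le> 2 * n"
    "2 * l * sum \<mu> (set C) \<le> sum \<mu> (rest B C W)"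
  shows "sep_inv B C W"
  using assms unfolding sep_inv_def by simp

lemma model_inv_supp: "model_inv W \<Longrightarrow> supp W \<subseteq> {..<n}"
  unfolding model_inv_def clique_model_def supp_def by auto

lemma model_inv_nonempty: "model_inv W \<Longrightarrow> X \<in> set W \<Longrightarrow> X \<noteq> []"
  unfolding model_inv_def clique_model_def induces_connected_def by auto

lemma card_rest_le:
  assumes "set B \<subseteq> {..<n}" "distinct B"
  shows "card (rest B C W) \<le> n - length B"
proof -
  have "card (rest B C W) \<le> card ({..<n} - set B)" unfolding rest_def by (intro card_mono) auto
  also have "\<dots> = n - length B" using assms by (simp add: card_Diff_subset distinct_card)
  finally show ?thesis .
qed

lemma model_inv_filter:
  assumes "model_inv W"
  shows "model_inv (filter P W)"
proof -
  have W: "distinct (map set W)" "\<forall>X\<in>set W. distinct X \<and> length X \<le> bound"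
    "clique_model {..<n} E (length W) (set ` set W)" "has_depth E d (set ` set W)" "length W \<le> m0"
    using assms unfolding model_inv_def by simp_all
  have sub: "set ` set (filter P W) \<subseteq> set ` set W" by auto
  have d: "distinct (map set (filter P W))" using W(1) by (rule distinct_map_filter)
  then have "card (set ` set (filter P W)) = length (filter P W)"
    using distinct_card[OF d] by simp
  then have "clique_model {..<n} E (length (filter P W)) (set ` set (filter P W))"
    by (rule clique_model_subset[OF W(3) sub])
  moreover have "has_depth E d (set ` set (filter P W))"
    using W(4) sub unfolding has_depth_def by blast
  moreover have "\<forall>X\<in>set (filter P W). distinct X \<and> length X \<le> bound" using W(2) by simp
  moreover have "length (filter P W) \<le> m0" using length_filter_le[of P W] W(5) by linarith
  ultimately show ?thesis using d unfolding model_inv_def by (intro conjI)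
qed

section \<open>The three kinds of steps preserve the invariant\<close>

text \<open>Dropped members join the rest, which only helps to pay for \<open>C\<close>. The rest
  stays small because more than two thirds of the vertices lie in \<open>B\<close>.\<close>

lemma sep_inv_remove:
  assumes inv: "sep_inv B C W" and big: "2 * n < 3 * length B"
    and P: "\<And>X x u. X \<in> set W \<Longrightarrow> \<not> P X \<Longrightarrow> x \<in> set X \<Longrightarrow> u \<in> set B \<Longrightarrow> (x, u) \<notin> E"
  shows "sep_inv B C (filter P W)"
proof -
  have supp: "supp (filter P W) \<subseteq> supp W" unfolding supp_def by auto
  note D = sep_invD[OF inv] and B = sep_invD(1,3)[OF inv]
  have "length B \<le> n" using length_distinct_le[OF B(1), of V] B(2) set_V length_V by simp
  then have card: "3 * card (rest B C (filter P W)) \<le> 2 * n"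
    using card_rest_le[OF B(2,1), of C "filter P W"] big by linarith
  have edges: "(u, b) \<notin> E" if "u \<in> rest B C (filter P W)" "b \<in> set B" for u b
  proof (cases "u \<in> rest B C W")
    case True
    then show ?thesis using that(2) by (rule D(9))
  next
    case False
    then have "u \<in> supp W" using that(1) unfolding rest_def by blast
    then obtain X where X: "X \<in> set W" "u \<in> set X" unfolding supp_def by auto
    moreover have "\<not> P X"
    proof
      assume "P X"
      with X have "u \<in> supp (filter P W)" unfolding supp_def by auto
      with that(1) show False unfolding rest_def by simp
    qed
    ultimately show ?thesis using that(2) by (intro P[of X u b])
  qed
  have "sum \<mu> (rest B C W) \<le> sum \<mu> (rest B C (filter P W))"
    unfolding rest_def using supp by (intro sum_mono2) auto
  then have "2 * l * sum \<mu> (set C) \<le> sum \<mu> (rest B C (filter P W))"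
    using D(11) by linarith
  moreover have "set B \<inter> supp (filter P W) = {}" "set C \<inter> supp (filter P W) = {}"
    using D(6,7) supp by blast+
  ultimately show ?thesis
    by (intro sep_invI D(1-5) model_inv_filter[OF D(8)] card edges)
qed

text \<open>All neighbours of \<open>S\<close> in \<open>B\<close> move to \<open>C\<close>, so
  \<open>S\<close> may join the rest. Its new cardinality is at most
  \<open>(n - length B) + length B / 2\<close>, which is below two thirds of \<open>n\<close>
  because \<open>B\<close> has more than two thirds. The measure of the new boundary is paid by that
  of \<open>S\<close>.\<close>

lemma sep_inv_cut:
  assumes inv: "sep_inv B C W" and big: "2 * n < 3 * length B"
    and S: "distinct S" "set S \<subseteq> set B" "2 * length S \<le> length B"
      "2 * l * sum_list (map \<mu> (boundary a V B S)) \<le> sum_list (map \<mu> S)"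
    and st: "cut_step a V S (B, C, W) = (B', C', W')"
  shows "sep_inv B' C' W'"
proof -
  define N where "N = boundary a V B S"
  note D = sep_invD[OF inv] and B = sep_invD(1,3,5,6)[OF inv]
  have N: "distinct N" "set N = {u \<in> set B. u \<notin> set S \<and> (\<exists>s\<in>set S. (s, u) \<in> E)}"
    unfolding N_def using distinct_boundary set_boundary[of B S] B(2) set_V by auto
  have eqs: "B' = filter (\<lambda>u. u \<notin> set S \<and> u \<notin> set N) B" "C' = N @ C" "W' = W"
    using st unfolding cut_step_def N_def by auto
  have rest: "rest B' C' W' = rest B C W \<union> set S"
  proof -
    have "set B' = set B - set S - set N" "set C' = set N \<union> set C" unfolding eqs by auto
    moreover have "set N \<subseteq> set B - set S" unfolding N(2) by blast
    ultimately show ?thesis unfolding rest_def eqs(3) using S(2) B(2-4) by blast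
  qed
  have disj: "rest B C W \<inter> set S = {}" using S(2) unfolding rest_def by auto
  have fin: "finite (rest B C W)" unfolding rest_def by simp
  have "length B \<le> n" using length_distinct_le[OF B(1), of V] B(2) set_V length_V by simp
  moreover have "card (rest B' C' W') = card (rest B C W) + length S"
    unfolding rest using card_Un_disjoint[OF fin _ disj] distinct_card[OF S(1)] by simp
  ultimately have card: "3 * card (rest B' C' W') \<le> 2 * n"
    using card_rest_le[OF B(2,1), of C W] big S(3) by linarith
  have edges: "(u, b) \<notin> E" if "u \<in> rest B' C' W'" "b \<in> set B'" for u b
  proof (cases "u \<in> set S")
    case True
    have "b \<in> set B" "b \<notin> set N" "b \<notin> set S" using that(2) unfolding eqs(1) by simp_all
    then show ?thesis using True unfolding N(2) by blast
  next
    case False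
    then have "u \<in> rest B C W" using that(1) unfolding rest by blast
    moreover have "b \<in> set B" using that(2) unfolding eqs by simp
    ultimately show ?thesis by (rule D(9))
  qed
  have "set N \<inter> set C = {}" using N(2) B(3) by auto
  then have "sum \<mu> (set C') = sum \<mu> (set N) + sum \<mu> (set C)" unfolding eqs by (simp add: sum.union_disjoint)
  moreover have "sum \<mu> (rest B' C' W') = sum \<mu> (rest B C W) + sum \<mu> (set S)"
    unfolding rest using sum.union_disjoint[OF fin _ disj] by simp
  moreover have "2 * l * sum \<mu> (set N) \<le> sum \<mu> (set S)"
    using S(4) N(1) S(1) unfolding N_def[symmetric] by (simp add: sum_list_distinct_conv_sum_set)
  moreover note D(11)
  ultimately have charge: "2 * l * sum \<mu> (set C') \<le> sum \<mu> (rest B' C' W')"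
    by (simp add: distrib_left)
  show ?thesis
  proof (rule sep_invI[OF _ _ _ _ _ _ _ _ edges card charge])
    have NB: "set N \<subseteq> set B" using N(2) by auto
    have C': "set C' = set N \<union> set C" and B': "set B' \<subseteq> set B" "set B' \<inter> set N = {}"
      unfolding eqs by auto
    show "distinct B'" "distinct C'" using D(1,2) N(1) \<open>set N \<inter> set C = {}\<close> unfolding eqs by simp_all
    show "set B' \<subseteq> {..<n}" "set C' \<subseteq> {..<n}" using C' B' NB D(3,4) by blast+
    show "set B' \<inter> set C' = {}" using C' B' B(3) by blast
    show "set B' \<inter> supp W' = {}" "set C' \<inter> supp W' = {}" unfolding eqs(3) using C' B' NB D(6,7) by blast+
    show "model_inv W'" unfolding eqs by (rule D(8))
  qed
qed

lemma set_ports: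
  assumes "\<And>X. X \<in> set W \<Longrightarrow> \<exists>x\<in>set X. \<exists>u\<in>set B. (x, u) \<in> E"
  shows "set (ports a B W) \<subseteq> set B" "X \<in> set W \<Longrightarrow> \<exists>x\<in>set X. \<exists>p\<in>set (ports a B W). (x, p) \<in> E"
proof -
  have *: "nth_default 0 (filter (\<lambda>u. \<exists>x\<in>set X. a x u) B) 0 \<in> {u \<in> set B. \<exists>x\<in>set X. a x u}"
    if "X \<in> set W" for X
  proof -
    have "filter (\<lambda>u. \<exists>x\<in>set X. a x u) B \<noteq> []" using assms[OF that] by (auto simp: filter_empty_conv)
    then have "nth_default 0 (filter (\<lambda>u. \<exists>x\<in>set X. a x u) B) 0 \<in> set (filter (\<lambda>u. \<exists>x\<in>set X. a x u) B)"
      by (simp add: nth_default_def del: set_filter)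
    then show ?thesis by simp
  qed
  then show "set (ports a B W) \<subseteq> set B" unfolding ports_def by auto
  show "\<exists>x\<in>set X. \<exists>p\<in>set (ports a B W). (x, p) \<in> E" if "X \<in> set W"
    using *[OF that] that unfolding ports_def by auto
qed

text \<open>The enlarged model itself witnesses that \<open>omega\<close> is at least
  \<open>Suc (length W)\<close>; therefore the size \<open>Suc (length W) * d\<close> of the new
  member stays within \<open>bound\<close>. The rest and \<open>C\<close> do not change.\<close>

lemma sep_inv_extend:
  assumes inv: "sep_inv B C W" and m: "length W < m0"
    and X: "X \<noteq> []" "distinct X" "set X \<subseteq> set B" "induces_connected E (set X)" "radius E (set X) \<le> d"
      "length X \<le> Suc (length W) * d"
    and adj: "\<And>Y. Y \<in> set W \<Longrightarrow> \<exists>y\<in>set Y. \<exists>x\<in>set X. (y, x) \<in> E"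
    and st: "extend_step X (B, C, W) = (B', C', W')"
  shows "sep_inv B' C' W'"
proof -
  have eqs: "B' = filter (\<lambda>u. u \<notin> set X) B" "C' = C" "W' = X # W"
    using st unfolding extend_step_def by auto
  note D = sep_invD[OF inv] and I = sep_invD(3,5,6,8)[OF inv]
  have XW: "set X \<inter> supp W = {}" using X(3) I(3) by auto
  have rest: "rest B' C' W' = rest B C W" unfolding eqs rest_def supp_def using X(3) by auto
  have M: "clique_model {..<n} E (length W) (set ` set W)" "has_depth E d (set ` set W)"
    "distinct (map set W)" "\<forall>Y\<in>set W. distinct Y \<and> length Y \<le> bound"
    using I(4) unfolding model_inv_def by auto
  have model: "clique_model {..<n} E (Suc (length W)) (insert (set X) (set ` set W))"
  proof (rule clique_model_insert[OF M(1) sym_E _ X(4)])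
    show "set X \<subseteq> {..<n}" using X(3) I(1) by blast
    show "set X \<inter> \<Union> (set ` set W) = {}" using XW unfolding supp_def .
    show "\<exists>y\<in>Y. \<exists>x\<in>set X. (y, x) \<in> E" if "Y \<in> set ` set W" for Y using adj that by blast
  qed
  have depth: "has_depth E d (insert (set X) (set ` set W))"
    using M(2) X(5) unfolding has_depth_def by simp
  have "Suc (length W) \<le> omega {..<n} E d" by (rule le_omega[OF _ model depth]) simp
  then have "Suc (length W) * d \<le> bound" unfolding bound_def using m by (intro mult_right_mono) auto
  then have len: "length X \<le> bound" using X(6) by linarith
  obtain x where "x \<in> set X" using X(1) by (cases X) auto
  then have "set X \<notin> set ` set W" using XW unfolding supp_def by blast
  then have "model_inv W'"
    unfolding model_inv_def eqs using model depth len M X(2) m by simp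
  moreover have B': "set B' \<subseteq> set B" "distinct B'" and W': "supp W' = set X \<union> supp W" "set B' \<inter> set X = {}"
    unfolding eqs supp_def using D(1) by auto
  moreover have "(u, b) \<notin> E" if "u \<in> rest B' C' W'" "b \<in> set B'" for u b
    using D(9)[of u b] that B' unfolding rest by blast
  moreover have "set B' \<inter> set C' = {}" "set C' \<inter> supp W' = {}"
    using B'(1) W'(1) X(3) D(5,7) unfolding eqs(2) by blast+
  moreover have "set B' \<inter> supp W' = {}" using B'(1) W' D(6) by blast
  moreover have "set B' \<subseteq> {..<n}" using B'(1) D(3) by blast
  moreover have "3 * card (rest B' C' W') \<le> 2 * n" "2 * l * sum \<mu> (set C') \<le> sum \<mu> (rest B' C' W')"
    using D(10,11) unfolding rest by (simp_all only: eqs(2))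
  ultimately show ?thesis using D(2,4) unfolding eqs(2) by (intro sep_invI)
qed

section \<open>Termination and the final state\<close>

definition sep_done :: "sep_state \<Rightarrow> bool" where
  "sep_done st \<longleftrightarrow> 3 * length (fst st) \<le> 2 * n \<or> length (snd (snd st)) = m0"

text \<open>The factor 2 makes an extension profitable: vertices moved from \<open>B\<close> into a
  member of \<open>W\<close> drop from weight 2 to weight 1. Dropping a member then releases the
  remaining 1.\<close>

definition potential :: "sep_state \<Rightarrow> nat" where
  "potential st = 2 * length (fst st) + sum_list (map length (snd (snd st)))"

abbreviation sinv :: "sep_state \<Rightarrow> bool" where "sinv st \<equiv> sep_inv (fst st) (fst (snd st)) (snd (snd st))"

lemma sum_list_filter_less:
  "X \<in> set W \<Longrightarrow> \<not> P X \<Longrightarrow> X \<noteq> [] \<Longrightarrow> sum_list (map length (filter P W)) < sum_list (map length W)"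
proof (induction W)
  case (Cons Y W)
  have "sum_list (map length (filter P W)) \<le> sum_list (map length W)"
    by (induction W) auto
  then show ?case using Cons length_greater_0_conv[of Y]
    by (cases "X = Y") (auto simp del: length_greater_0_conv)
qed simp

lemma sep_step_done: "sep_done st \<Longrightarrow> sep_step a V \<mu> l m0 st = st"
  unfolding sep_done_def sep_step_def by (auto simp: length_V split: prod.splits)

lemma sep_step_inv:
  assumes inv: "sinv st" and nd: "\<not> sep_done st"
  shows "sinv (sep_step a V \<mu> l m0 st)" "potential (sep_step a V \<mu> l m0 st) < potential st"
proof -
  obtain B C W where st: "st = (B, C, W)" by (cases st)
  have inv: "sep_inv B C W" using inv st by simp
  have big: "2 * n < 3 * length B" and ne: "length W \<noteq> m0" using nd unfolding sep_done_def st by auto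
  have I: "distinct B" "set B \<subseteq> set V" "model_inv W"
    unfolding set_V using sep_invD(1,3,8)[OF inv] by simp_all
  have m: "length W < m0" using I(3) ne unfolding model_inv_def by auto
  have B_ne: "B \<noteq> []" using big by auto
  have c: "\<not> (3 * length B \<le> 2 * length V \<or> length W = m0)" using big ne length_V by simp
  let ?st' = "sep_step a V \<mu> l m0 st"
  have "sinv ?st' \<and> potential ?st' < potential st"
  proof (cases "\<exists>X\<in>set W. \<forall>x\<in>set X. \<forall>u\<in>set B. \<not> a x u")
    case True
    let ?P = "\<lambda>X. \<exists>x\<in>set X. \<exists>u\<in>set B. a x u"
    have st': "?st' = (B, C, filter ?P W)"
      unfolding sep_step_def st prod.case if_not_P[OF c] if_P[OF True] ..
    have "sep_inv B C (filter ?P W)" by (rule sep_inv_remove[OF inv big]) blast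
    moreover obtain X where "X \<in> set W" "\<not> ?P X" using True by blast
    then have "sum_list (map length (filter ?P W)) < sum_list (map length W)"
      using model_inv_nonempty[OF I(3)] by (intro sum_list_filter_less)
    ultimately show ?thesis unfolding st' by (simp add: potential_def st)
  next
    case False
    then have nbr: "\<exists>x\<in>set X. \<exists>u\<in>set B. (x, u) \<in> E" if "X \<in> set W" for X using that by blast
    have ports: "set (ports a B W) \<subseteq> set B"
      "\<And>X. X \<in> set W \<Longrightarrow> \<exists>x\<in>set X. \<exists>p\<in>set (ports a B W). (x, p) \<in> E"
      by (rule set_ports[OF nbr]; assumption)+
    show ?thesis
    proof (cases "small_ports a V \<mu> l B W = []")
      case True
      let ?ps = "ports a B W"
      define X where "X = branch_set a V B ?ps"
      have st': "?st' = extend_step X (B, C, W)"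
        unfolding sep_step_def st prod.case if_not_P[OF c] if_not_P[OF False] if_P[OF True] X_def ..
      \<comment> \<open>Both balls contain more than half of \<open>B\<close>, so they share a
        vertex \<open>u\<close>; a walk from \<open>p\<close> to \<open>u\<close> is followed by the
        reverse of one from \<open>q\<close> to \<open>u\<close>.\<close>
      have near: "\<exists>j\<le>min (2 * k) (2 * n). (p, q) \<in> (Restr E (set B)) ^^ j"
        if pq: "p \<in> set ?ps" "q \<in> set ?ps" for p q
      proof -
        have B_pq: "p \<in> set B" "q \<in> set B" using pq ports(1) by auto
        note gp = grow_props[OF I(2) B_pq(1)] and gq = grow_props[OF I(2) B_pq(2)]
        let ?S = "\<lambda>p. set (grow a V \<mu> l B p)"
        have "length B < 2 * length (grow a V \<mu> l B p)" "length B < 2 * length (grow a V \<mu> l B q)"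
          using True pq unfolding small_ports_def filter_empty_conv by auto
        then have "card (set B) < card (?S p) + card (?S q)"
          using distinct_card[OF I(1)] distinct_card[OF gp(3)] distinct_card[OF gq(3)] by linarith
        moreover have "card (?S p \<union> ?S q) \<le> card (set B)" using gp(2) gq(2) by (intro card_mono) auto
        ultimately have "?S p \<inter> ?S q \<noteq> {}"
          using card_Un_disjoint[of "?S p" "?S q"] by auto
        then obtain u where u: "u \<in> ?S p" "u \<in> ?S q" by blast
        from gp(4)[OF u(1)] obtain j1 where j1: "j1 \<le> min k n" "(p, u) \<in> (Restr E (set B)) ^^ j1" by (elim exE conjE)
        from gq(4)[OF u(2)] obtain j2 where j2: "j2 \<le> min k n" "(q, u) \<in> (Restr E (set B)) ^^ j2" by (elim exE conjE)
        have "sym (Restr E (set B))" using sym_E by (auto simp: sym_def)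
        from relpow_sym[OF this j2(2)] have "(p, q) \<in> (Restr E (set B)) ^^ (j1 + j2)"
          unfolding relpow_add using j1(2) by (rule relcompI[rotated])
        moreover have "j1 + j2 \<le> min (2 * k) (2 * n)" using j1(1) j2(1) by simp
        ultimately show ?thesis by (intro exI[of _ "j1 + j2"] conjI)
      qed
      have X: "X \<noteq> []" "distinct X" "set X \<subseteq> set B" "set ?ps \<subseteq> set X" "induces_connected E (set X)"
        "radius E (set X) \<le> d" "length X \<le> Suc (length ?ps) * d"
        unfolding X_def using branch_set_props[OF I(2) B_ne ports(1)] near by simp_all
      have "length ?ps = length W" by (simp add: ports_def)
      then have "length X \<le> Suc (length W) * d" using X(7) by simp
      moreover have "\<exists>y\<in>set Y. \<exists>x\<in>set X. (y, x) \<in> E" if "Y \<in> set W" for Y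
        using ports(2)[OF that] X(4) by blast
      ultimately have "sinv ?st'"
        unfolding st' by (intro sep_inv_extend[OF inv m X(1,2,3,5,6)]) auto
      moreover have "length (filter (\<lambda>u. u \<notin> set X) B) + length X = length B"
      proof -
        have "length (filter (\<lambda>u. u \<notin> set X) B) = card (set B - set X)"
          using distinct_card[OF distinct_filter[OF I(1)], of "\<lambda>u. u \<notin> set X"]
          by (simp add: set_diff_eq)
        moreover have "card (set X) \<le> card (set B)" using X(3) by (intro card_mono) auto
        ultimately show ?thesis
          using X(3) distinct_card[OF X(2)] distinct_card[OF I(1)] by (simp add: card_Diff_subset)
      qed
      then have "potential ?st' < potential st"
        unfolding st' using X(1) by (cases X) (simp_all add: potential_def st extend_step_def)
      ultimately show ?thesis ..
    next
      case small: False
      define v where "v = nth_default 0 (small_ports a V \<mu> l B W) 0"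
      define S where "S = grow a V \<mu> l B v"
      have st': "?st' = cut_step a V S (B, C, W)"
        unfolding sep_step_def st prod.case if_not_P[OF c] if_not_P[OF False] if_not_P[OF small] S_def v_def ..
      have "v \<in> set (small_ports a V \<mu> l B W)" unfolding v_def using small by (simp add: nth_default_def)
      then have v: "v \<in> set (ports a B W)" "2 * length S \<le> length B"
        unfolding S_def small_ports_def by auto
      then have vB: "v \<in> set B" using ports(1) by auto
      note S = grow_props[OF I(2) vB, folded S_def]
      have "sinv ?st'" unfolding st' by (intro sep_inv_cut[OF inv big S(3,2) v(2) S(5)]) auto
      moreover have "length (filter (\<lambda>u. u \<notin> set S \<and> u \<notin> set (boundary a V B S)) B) < length B"
        using vB S(1) by (intro length_filter_less[of v]) auto
      then have "potential ?st' < potential st"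
        unfolding st' by (simp add: potential_def st cut_step_def)
      ultimately show ?thesis ..
    qed
  qed
  then show "sinv ?st'" "potential ?st' < potential st" by auto
qed

text \<open>Every unfinished step lowers the potential and finished states are fixed points.
  Potential zero means that \<open>B\<close> is empty, which counts as finished.\<close>

lemma sep_steps:
  "sinv st \<Longrightarrow> potential st \<le> i \<Longrightarrow>
    sinv ((sep_step a V \<mu> l m0 ^^ i) st) \<and> sep_done ((sep_step a V \<mu> l m0 ^^ i) st)"
proof (induction i arbitrary: st)
  case 0
  then show ?case by (simp add: sep_done_def potential_def)
next
  case (Suc i)
  show ?case
  proof (cases "sep_done st")
    case True
    have fixed: "(sep_step a V \<mu> l m0 ^^ j) st = st" for j
      by (induction j) (simp_all add: sep_step_done[OF True])
    show ?thesis unfolding fixed using True Suc.prems(1) by (rule conjI[rotated])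
  next
    case False
    have "sinv ((sep_step a V \<mu> l m0 ^^ i) (sep_step a V \<mu> l m0 st)) \<and>
        sep_done ((sep_step a V \<mu> l m0 ^^ i) (sep_step a V \<mu> l m0 st))"
      using sep_step_inv[OF Suc.prems(1) False] Suc.prems(2) by (intro Suc.IH) auto
    then show ?thesis by (simp only: funpow_Suc_right comp_apply)
  qed
qed

lemma sep_final_inv:
  "sinv (sep_final a V \<mu> l m0)" "sep_done (sep_final a V \<mu> l m0)"
proof -
  have "supp [] = {}" by (simp add: supp_def)
  moreover have "rest V [] [] = {}" unfolding rest_def using set_V by auto
  moreover have "model_inv []"
    unfolding model_inv_def clique_model_def has_depth_def by simp
  ultimately have "sinv (V, [], [])"
    using distinct_V set_V unfolding sep_inv_def by simp
  moreover have "potential (V, [], []) \<le> length (V @ V)" by (simp add: potential_def)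
  ultimately have "sinv (sep_final a V \<mu> l m0) \<and> sep_done (sep_final a V \<mu> l m0)"
    unfolding sep_final_def fold_const by (intro sep_steps)
  then show "sinv (sep_final a V \<mu> l m0)" "sep_done (sep_final a V \<mu> l m0)" by auto
qed

end


section \<open>Correctness\<close>

context separation
begin

text \<open>What remains consists of the rest and \<open>B\<close>. They have no edges between them,
  and each has at most two thirds of the vertices.\<close>

lemma sep_final_balanced:
  assumes inv: "sep_inv B C W" and small: "3 * length B \<le> 2 * n"
  shows "balanced_separator {..<n} E (set C \<union> supp W)"
proof -
  note D = sep_invD[OF inv]
  have split: "{..<n} - (set C \<union> supp W) = rest B C W \<union> set B"
    unfolding rest_def using D(3,5,6) by blast
  have "real (card K) \<le> 2 / 3 * real n" if "K \<in> components E (rest B C W \<union> set B)" for K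
  proof -
    have "K \<subseteq> rest B C W \<or> K \<subseteq> set B" using components_subset[OF sym_E D(9) that] by blast
    moreover have "finite (rest B C W)" unfolding rest_def by simp
    ultimately have "card K \<le> card (rest B C W) \<or> card K \<le> length B"
      by (metis card_mono card_length List.finite_set order_trans)
    then have "3 * card K \<le> 2 * n" using D(10) small by linarith
    then show ?thesis by simp
  qed
  then show ?thesis
    unfolding balanced_separator_def split using D(4) model_inv_supp[OF D(8)] by simp
qed

text \<open>The factor 2 in the invariant cancels against the 2 in the bound
  \<open>2 * n * w\<close> on the total measure.\<close>

lemma sep_final_charge:
  assumes "sep_inv B C W"
  shows "l * sum \<mu> (set C) \<le> n * w"
proof -
  have "sum \<mu> (rest B C W) \<le> sum \<mu> {..<n}" unfolding rest_def by (intro sum_mono2) auto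
  then show ?thesis using sep_invD(11)[OF assms] \<mu>_total by linarith
qed

lemma sep_result_cases:
  fixes out :: data
  defines "out \<equiv> sep_result V m0 (sep_final a V \<mu> l m0)"
  obtains
    (model) \<W> where "returns_model out \<W>" "clique_model {..<n} E m0 \<W>" "has_depth E d \<W>" "is_bounded m0 d \<W>"
  | (sets) C M m \<W> where "returns_sets out C M" "C \<subseteq> {..<n}" "M \<subseteq> {..<n}" "C \<inter> M = {}"
      "balanced_separator {..<n} E (C \<union> M)" "l * sum \<mu> C \<le> n * w"
      "m \<le> min m0 (omega {..<n} E d)" "clique_model {..<n} E m \<W>" "has_depth E d \<W>"
      "is_bounded (min m0 (omega {..<n} E d)) d \<W>" "M = \<Union>\<W>"
proof -
  obtain B C W where st: "sep_final a V \<mu> l m0 = (B, C, W)" by (cases "sep_final a V \<mu> l m0")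
  have inv: "sep_inv B C W" and fin: "3 * length B \<le> 2 * n \<or> length W = m0"
    using sep_final_inv unfolding st sep_done_def by simp_all
  note D = sep_invD[OF inv]
  have W: "distinct (map set W)" "\<forall>X\<in>set W. distinct X \<and> length X \<le> bound"
    "clique_model {..<n} E (length W) (set ` set W)" "has_depth E d (set ` set W)" "length W \<le> m0"
    using D(8) unfolding model_inv_def by simp_all
  have vertices: "represents_vertices (encode X) (set X)" if "distinct X" for X :: "nat list"
    unfolding represents_vertices_def represents_set_def encode_list_eq
    using that by (intro exI[of _ X] exI[of _ "map encode X"]) (simp add: list_all2_conv_all_nth)
  have card_le: "card (set X) \<le> bound" if "X \<in> set W" for X
    using W(2) that card_length[of X] by (meson order_trans)
  have bd: "is_bounded (min m0 (omega {..<n} E d)) d (set ` set W)"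
    using card_le unfolding is_bounded_def bound_def by simp
  show thesis
  proof (cases "length W = m0")
    case True
    have "represents_set represents_vertices (encode W) (set ` set W)"
      unfolding represents_set_def encode_list_eq[of W]
      using W(1,2) vertices
      by (intro exI[of _ "map set W"] exI[of _ "map encode W"]) (simp add: list_all2_conv_all_nth)
    then have "returns_model out (set ` set W)"
      unfolding returns_model_def out_def st sep_result_def using True by simp
    moreover have "is_bounded m0 d (set ` set W)"
      using bd unfolding is_bounded_def by (meson min.cobounded1 mult_le_mono1 order_trans)
    ultimately show thesis using W(3,4) True by (intro model) simp_all
  next
    case False
    define M where "M = filter (\<lambda>u. \<exists>X\<in>set W. u \<in> set X) V"
    have M: "set M = supp W" "distinct M"
      unfolding M_def using model_inv_supp[OF D(8)] distinct_V set_V unfolding supp_def by auto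
    have "returns_sets out (set C) (supp W)"
      unfolding returns_sets_def out_def st sep_result_def M(1)[symmetric]
      using False vertices[OF M(2)] vertices[OF D(2)] by (simp add: M_def[symmetric])
    moreover have "length W \<le> min m0 (omega {..<n} E d)"
      using W(5) le_omega[OF _ W(3,4)] by simp
    moreover have "3 * length B \<le> 2 * n" using fin False by simp
    ultimately show thesis
      using sep_final_balanced[OF inv] sep_final_charge[OF inv] D(4,7) model_inv_supp[OF D(8)] W bd
      by (intro sets[of "set C" "supp W" "length W" "set ` set W"]) (simp_all add: supp_def)
  qed
qed

end

section \<open>Monotonicity and growth of the depth function\<close>

lemma depth_mono: "mono depth" "mono (depth l)"
proof -
  have "depth l n \<le> depth l' n'" if "l \<le> l'" "n \<le> n'" for l l' n n'
    unfolding depth_def half_depth_def using that floorlog_mono[of n n' 2]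
    by (intro add_mono mult_mono) auto
  then show "mono depth" "mono (depth l)" by (auto simp: mono_def le_fun_def)
qed

text \<open>For \<open>n\<close> at least 2 the logarithm to base 2 is at least 1, so
  \<open>floorlog 2 n + 1\<close> is at most three times it. With the factor \<open>4 * l\<close>
  this gives 12, and the final summand 1 of \<open>depth\<close> makes it 13.\<close>

lemma depth_bigo:
  "(\<lambda>(l, n). real (depth l n)) \<in> O[principal ({1..} \<times> {2..})](\<lambda>(l, n). real l * ln (real n))"
proof (rule bigoI[of _ "13 / ln 2"])
  have "real (depth l n) \<le> 13 / ln 2 * (real l * ln (real n))" if "1 \<le> l" "2 \<le> n" for l n
  proof -
    have log1: "1 \<le> log 2 (real n)" using that(2) by (simp add: le_log_iff)
    have "real (floorlog 2 n) \<le> log 2 (real n) + 1"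
      unfolding floorlog_def using that(2) log1 by (auto simp: nat_add_distrib)
    then have "real (floorlog 2 n) + 1 \<le> 3 * log 2 (real n)" using log1 by linarith
    then have "4 * real l * (real (floorlog 2 n) + 1) \<le> 4 * real l * (3 * log 2 (real n))"
      by (intro mult_left_mono) auto
    moreover have "1 \<le> real l * log 2 (real n)" using that(1) log1 mult_mono[of 1 "real l" 1 "log 2 (real n)"] by simp
    moreover have "real (depth l n) = 4 * real l * (real (floorlog 2 n) + 1) + 1"
      by (simp add: depth_def half_depth_def algebra_simps)
    ultimately have "real (depth l n) \<le> 13 * (real l * log 2 (real n))" by (simp add: mult.assoc)
    then show ?thesis by (simp add: log_def)
  qed
  moreover have "0 \<le> real l * ln (real n)" if "2 \<le> n" for l n using that by simp
  ultimately show "\<forall>\<^sub>F x in principal ({1..} \<times> {2..}).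
      norm (case x of (l, n) \<Rightarrow> real (depth l n)) \<le> 13 / ln 2 * norm (case x of (l, n) \<Rightarrow> real l * ln (real n))"
    unfolding eventually_principal by (auto simp: abs_mult)
qed

text \<open>Instances contain sets and functions, which have no encoding of their own as values;
  each is therefore matched with a value of an encodable type that has the same encoding.\<close>

lemma poly_time_algorithm_ptime:
  fixes f :: "'a::enc \<Rightarrow> data"
  assumes "ptime f" "\<And>i. i \<in> I \<Longrightarrow> \<exists>x. encode x = enc i \<and> R i (f x)"
  shows "\<exists>alg. poly_time_algorithm alg I enc R"
proof -
  obtain c T where T: "poly_bounded T"
    "\<And>s x. s 0 = encode x \<Longrightarrow> runs c s (T x) (\<lambda>s'. s' 0 = encode (f x) \<and> (\<forall>v<0. s' v = s v))"
    by (rule ptimeE[OF assms(1), of 0]) (rule that)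
  obtain p where p: "\<And>x. T x \<le> poly p (esize x)" using T(1) unfolding poly_bounded_def by blast
  have "\<exists>t s. exec c ((\<lambda>_. Atom 0)(0 := enc i)) t s \<and> t \<le> poly p (data_size (enc i)) \<and> R i (s 0)"
    if "i \<in> I" for i
  proof -
    obtain x where x: "encode x = enc i" "R i (f x)" using assms(2)[OF \<open>i \<in> I\<close>] by blast
    obtain t s where "exec c ((\<lambda>_. Atom 0)(0 := enc i)) t s" "t \<le> T x" "s 0 = f x"
      using T(2)[of "(\<lambda>_. Atom 0)(0 := enc i)" x] x(1) unfolding runs_def by auto
    then show ?thesis using p[of x] x by (intro exI[of _ t] exI[of _ s]) auto
  qed
  then show ?thesis unfolding poly_time_algorithm_def by blast
qed

section \<open>Instances and their scaled costs\<close>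

definition input_of :: "problem_instance \<Rightarrow> input" where
  "input_of = (\<lambda>(n, E, l, m0, q).
     (map (\<lambda>u. map (\<lambda>v. (u, v) \<in> E) [0..<n]) [0..<n], l, m0,
      map (\<lambda>v. (nat (fst (quotient_of (q v))), nat (snd (quotient_of (q v))))) [0..<n], 0))"

lemma encode_input_of: "encode (input_of i) = data_of_instance i"
  unfolding input_of_def data_of_instance_def
  by (cases i) (simp add: encode_list_eq data_of_rat_def comp_def case_prod_beta data_of_list_def)

locale separator_instance =
  fixes n :: nat and E :: "nat rel" and l m0 :: nat and q :: "nat \<Rightarrow> rat"
  assumes inst: "(n, E, l, m0, q) \<in> instances"
begin

definition x :: input where "x = input_of (n, E, l, m0, q)"

definition den :: rat where "den = (\<Prod>v<n. of_int (snd (quotient_of (q v))))"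

definition total :: nat where "total = sum (weight x) {..<n}"

lemma inst_props: "simple_graph {..<n} E" "1 \<le> l" "\<And>v. v < n \<Longrightarrow> 0 \<le> q v"
  using inst unfolding instances_def by auto

lemma x_simps: "fst (snd x) = l" "fst (snd (snd x)) = m0" "verts x = rev [0..<n]"
  unfolding x_def input_of_def verts_def by simp_all

lemma adj_x: "adj x = (\<lambda>u v. (u, v) \<in> E)"
proof (intro ext)
  fix u v
  have "E \<subseteq> {..<n} \<times> {..<n}" using inst_props(1) unfolding simple_graph_def by blast
  then show "adj x u v = ((u, v) \<in> E)"
    unfolding adj_def x_def input_of_def by (auto simp: nth_default_def)
qed

lemma den_pos: "0 < den"
  unfolding den_def using quotient_of_denom_pos' by (intro prod_pos) simp

text \<open>The one factor of \<open>den\<close> that \<open>weight\<close> omits is the denominator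
  of \<open>q v\<close>, and it turns \<open>q v\<close> into its numerator. Since
  \<open>q v\<close> is nonnegative, \<open>nat\<close> loses nothing.\<close>

lemma weight_x:
  assumes v: "v < n"
  shows "rat_of_nat (weight x v) = q v * den"
proof -
  let ?a = "\<lambda>v. fst (quotient_of (q v))" and ?b = "\<lambda>v. snd (quotient_of (q v))"
  have b: "0 < ?b u" for u using quotient_of_denom_pos' by simp
  have qv: "q v = of_int (?a v) / of_int (?b v)" by (rule quotient_of_div) simp
  from inst_props(3)[OF v] this have "0 \<le> rat_of_int (?a v) / of_int (?b v)" by (rule ord_le_eq_trans)
  then have a: "0 \<le> ?a v" using b[of v] by (simp add: zero_le_divide_iff)
  have "rat_of_int (?b v) \<noteq> 0" using b[of v] by simp
  from iffD1[OF nonzero_eq_divide_eq[OF this] qv] have a_eq: "rat_of_int (?a v) = q v * of_int (?b v)" by (rule sym)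
  have dist: "distinct (filter (\<lambda>u. u \<noteq> v) (rev [0..<n]))" by simp
  have set: "set (filter (\<lambda>u. u \<noteq> v) (rev [0..<n])) = {..<n} - {v}" by auto
  have "weight x v = nat (?a v) * (\<Prod>u\<in>{..<n} - {v}. nat (?b u))"
    unfolding weight_def x_simps prod.distinct_set_conv_list[OF dist, symmetric] set
    using v by (auto simp: x_def input_of_def nth_default_def intro!: prod.cong)
  then have "rat_of_nat (weight x v) = of_int (?a v) * (\<Prod>u\<in>{..<n} - {v}. of_int (?b u))"
    using a b by (simp add: of_nat_nat order_less_imp_le)
  also have "\<dots> = q v * den"
    unfolding den_def a_eq using v prod.remove[of "{..<n}" v "\<lambda>u. rat_of_int (?b u)"]
    by (simp add: mult.assoc)
  finally show ?thesis .
qed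

lemma charge_x: "v < n \<Longrightarrow> charge x v = n * weight x v + total"
  unfolding charge_def x_simps total_def by (simp add: sum_list_distinct_conv_sum_set atLeast0LessThan)

text \<open>Here \<open>w\<close> is \<open>total\<close>: the terms \<open>n * weight x v\<close>
  sum to \<open>n * total\<close>, and so do the \<open>n\<close> copies of
  \<open>total\<close>.\<close>

sublocale separation n E "rev [0..<n]" l m0 "charge x" total
proof
  show "simple_graph {..<n} E" "1 \<le> l" by (rule inst_props)+
  show "set (rev [0..<n]) = {..<n}" by auto
  show "total \<le> charge x v" if "v < n" for v using charge_x[OF that] by simp
  have "sum (charge x) {..<n} = (\<Sum>v<n. n * weight x v + total)" by (intro sum.cong) (simp_all add: charge_x)
  then show "sum (charge x) {..<n} \<le> 2 * n * total"
    by (simp add: sum.distrib total_def flip: sum_distrib_left)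
qed simp

lemma separate_x:
  "separate x = sep_result (rev [0..<n]) m0 (sep_final (\<lambda>u v. (u, v) \<in> E) (rev [0..<n]) (charge x) l m0)"
  unfolding separate_def x_simps adj_x ..

text \<open>The measure dominates \<open>n\<close> times the scaled cost, so \<open>n\<close>
  cancels, and then the positive common factor \<open>den\<close>. For \<open>n = 0\<close> the set
  \<open>C\<close> is empty.\<close>

lemma cost_le:
  assumes C: "C \<subseteq> {..<n}" and le: "l * sum (charge x) C \<le> n * total"
  shows "sum q C \<le> sum q {..<n} / of_nat l"
proof (cases "n = 0")
  case False
  have "sum (charge x) C = (\<Sum>v\<in>C. n * weight x v + total)"
    using C by (intro sum.cong refl charge_x) auto
  then have "n * sum (weight x) C \<le> sum (charge x) C" by (simp add: sum.distrib sum_distrib_left)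
  then have "n * (l * sum (weight x) C) \<le> l * sum (charge x) C"
    by (metis mult.left_commute mult_le_mono2)
  then have "n * (l * sum (weight x) C) \<le> n * total" using le by linarith
  then have "l * sum (weight x) C \<le> total" using False by simp
  then have "rat_of_nat (l * sum (weight x) C) \<le> of_nat total" by (simp only: of_nat_le_iff)
  moreover have "rat_of_nat (sum (weight x) D) = sum q D * den" if "D \<subseteq> {..<n}" for D
    using that weight_x by (auto simp: sum_distrib_right intro!: sum.cong)
  ultimately have "(of_nat l * sum q C) * den \<le> sum q {..<n} * den"
    using C unfolding total_def by (simp add: mult.assoc)
  then have "of_nat l * sum q C \<le> sum q {..<n}" using den_pos by simp
  then show ?thesis using inst_props(2) by (simp add: field_simps)
qed (use C in simp)

lemma separate_correct:
  "(\<exists>W. returns_model (separate x) W \<and>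
       clique_model {..<n} E m0 W \<and> has_depth E d W \<and> is_bounded m0 d W) \<or>
   (\<exists>C M. returns_sets (separate x) C M \<and>
       C \<subseteq> {..<n} \<and> M \<subseteq> {..<n} \<and> C \<inter> M = {} \<and>
       balanced_separator {..<n} E (C \<union> M) \<and>
       sum q C \<le> sum q {..<n} / of_nat l \<and>
       (\<exists>m W. m \<le> min m0 (omega {..<n} E d) \<and>
              clique_model {..<n} E m W \<and> has_depth E d W \<and>
              is_bounded (min m0 (omega {..<n} E d)) d W \<and>
              M = \<Union>W))"
proof (cases rule: sep_result_cases)
  case (model \<W>)
  then show ?thesis unfolding separate_x by blast
next
  case (sets C M m \<W>)
  have "sum q C \<le> sum q {..<n} / of_nat l" by (rule cost_le[OF sets(2,6)])
  with sets show ?thesis unfolding separate_x by blast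
qed

end

theorem theorem5:
  shows "\<exists>d :: nat \<Rightarrow> nat \<Rightarrow> nat.
    mono d \<and> (\<forall>l. mono (d l)) \<and>
    (\<lambda>(l, n). real (d l n)) \<in> O[principal ({1..} \<times> {2..})](\<lambda>(l, n). real l * ln (real n)) \<and>
    (\<exists>alg. poly_time_algorithm alg instances data_of_instance
      (\<lambda>(n, E, l, m0, q) out.
        (\<exists>W. returns_model out W \<and>
             clique_model {..<n} E m0 W \<and> has_depth E (d l n) W \<and> is_bounded m0 (d l n) W) \<or>
        (\<exists>C M. returns_sets out C M \<and>
             C \<subseteq> {..<n} \<and> M \<subseteq> {..<n} \<and> C \<inter> M = {} \<and>
             balanced_separator {..<n} E (C \<union> M) \<and>
             sum q C \<le> sum q {..<n} / of_nat l \<and>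
             (\<exists>m W. m \<le> min m0 (omega {..<n} E (d l n)) \<and>
                    clique_model {..<n} E m W \<and> has_depth E (d l n) W \<and>
                    is_bounded (min m0 (omega {..<n} E (d l n))) (d l n) W \<and>
                    M = \<Union>W))))"
proof (intro exI[of _ depth] conjI allI depth_mono depth_bigo poly_time_algorithm_ptime[OF ptime_separate])
  fix i assume "i \<in> instances"
  obtain n E l m0 q where i: "i = (n, E, l, m0, q)" by (cases i)
  interpret separator_instance n E l m0 q
    using \<open>i \<in> instances\<close> unfolding i by unfold_locales
  from separate_correct show "\<exists>x. encode x = data_of_instance i \<and>
      (case i of (n, E, l, m0, q) \<Rightarrow> \<lambda>out.
        (\<exists>W. returns_model out W \<and>
             clique_model {..<n} E m0 W \<and> has_depth E (depth l n) W \<and> is_bounded m0 (depth l n) W) \<or>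
        (\<exists>C M. returns_sets out C M \<and>
             C \<subseteq> {..<n} \<and> M \<subseteq> {..<n} \<and> C \<inter> M = {} \<and>
             balanced_separator {..<n} E (C \<union> M) \<and>
             sum q C \<le> sum q {..<n} / of_nat l \<and>
             (\<exists>m W. m \<le> min m0 (omega {..<n} E (depth l n)) \<and>
                    clique_model {..<n} E m W \<and> has_depth E (depth l n) W \<and>
                    is_bounded (min m0 (omega {..<n} E (depth l n))) (depth l n) W \<and>
                    M = \<Union>W))) (separate x)"
    unfolding i prod.case by (intro exI[of _ x] conjI) (simp_all only: x_def encode_input_of)
qed

end
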